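(* The quaternary quadratic form $Q_{45}^1=x^2+2y^2+4z^2+7w^2+2yw+2yz$ (Gram matrix $\begin{pmatrix}1&0&0&0\\0&2&1&1\\0&1&4&0\\0&1&0&7\end{pmatrix}$) is primitively universal.
   Context: A quadratic form $f$ in variables $x,y,z,w$ is primitively universal if for every positive integer $n$ the equation $f(x,y,z,w)=n$ has an integer solution with $\gcd(x,y,z,w)=1$. *)

theory Defs imports Main begin

definition primitively_universal :: "(int \<Rightarrow> int \<Rightarrow> int \<Rightarrow> int \<Rightarrow> int) \<Rightarrow> bool" where
  "primitively_universal f \<longleftrightarrow>
     (\<forall>n>0. \<exists>x y z w. f x y z w = n \<and> Gcd {x, y, z, w} = 1)"

definition Q45_1 :: "int \<Rightarrow> int \<Rightarrow> int \<Rightarrow> int \<Rightarrow> int" where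
  "Q45_1 x y z w = x^2 + 2 * y^2 + 4 * z^2 + 7 * w^2 + 2 * y * w + 2 * y * z"

definition Gram45_1 :: "int list list" where
  "Gram45_1 = [[1, 0, 0, 0], [0, 2, 1, 1], [0, 1, 4, 0], [0, 1, 0, 7]]"

(* The Gram matrix A carries half of each cross coefficient: Q(v) = v^T A v. *)
lemma Q45_1_Gram:
  "Q45_1 x y z w =
     (\<Sum>i<4. \<Sum>j<4. Gram45_1 ! i ! j * ([x, y, z, w] ! i) * ([x, y, z, w] ! j))"
  by (simp add: Q45_1_def Gram45_1_def numeral_eq_Suc algebra_simps)

end

theory Submission
  imports Defs "HOL-Number_Theory.Number_Theory" "HOL-Analysis.Summation_Tests"
begin

text \<open>
  In suitable coordinates \<open>Q45_1\<close> is \<open>x^2 + t^2 + 2 a^2 + 2 a b + 3 b^2\<close> restricted to the sublattice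
  \<open>3 dvd t + b\<close>. For a given \<open>n\<close> one chooses \<open>x\<close> from a short list, according to \<open>n mod 30\<close>, such that
  \<open>n - x^2\<close> is odd and prime to 5. Such numbers are primitively represented by the ternary form
  \<open>t^2 + 2 a^2 + 2 a b + 3 b^2\<close> of determinant 5, and the residue of \<open>x\<close> is chosen such that the
  congruence modulo 3 holds automatically up to symmetries, except in one case, which a reflection repairs.

  The ternary statement follows Gauss: for \<open>N\<close> odd and prime to 5 one builds a positive ternary form of
  determinant 5 with leading coefficient \<open>N\<close>, whose residue form modulo 5 is anisotropic; reduction
  theory leaves only \<open>t^2 + 2 a^2 + 2 a b + 3 b^2\<close>. The construction needs a number \<open>c\<close> such that \<open>- c\<close> is
  a square modulo \<open>N\<close>, \<open>- 5 N\<close> is a square modulo \<open>c\<close>, and \<open>c\<close> is a nonresidue modulo 5.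
  Dirichlet's theorem would give a prime \<open>c\<close>, but a product of primes that split in the quadratic field
  suffices. If no such product lay in the required class of residues modulo squares, then some real character
  \<open>\<psi>\<close> would be trivial on all primes with \<open>\<eta> p = 1\<close>, where \<open>\<eta>\<close> is the quadratic character of \<open>- 5 N\<close>.
  The Dirichlet convolutions \<open>1 * \<eta>\<close> and \<open>\<psi> * \<psi> \<eta>\<close> would then agree on the integers prime to the modulus.
  Weighted with \<open>1 / sqrt n\<close>, the first has partial sums that exceed those of the harmonic series over
  such integers, because it is positive at squares, while those of the second stay bounded by the hyperbola
  method.
\<close>

section \<open>Real characters and split primes\<close>

text \<open>Summation by parts: each partial sum of \<open>a\<close> is bounded by \<open>B\<close>,
  and the nonnegative decrements of \<open>w\<close> telescope.\<close>

lemma abel_bound: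
  fixes a w :: "nat \<Rightarrow> real"
  assumes A: "\<And>j. \<bar>\<Sum>i<j. a i\<bar> \<le> B" and dec: "\<And>i. w (Suc i) \<le> w i" and nn: "\<And>i. 0 \<le> w i"
  shows "\<bar>\<Sum>i<k. a i * w i\<bar> \<le> B * w 0"
proof -
  have eq: "(\<Sum>i<k. a i * w i) = (\<Sum>i<k. a i) * w k + (\<Sum>i<k. (\<Sum>j<Suc i. a j) * (w i - w (Suc i)))"
    by (induction k) (auto simp: algebra_simps)
  have "\<bar>\<Sum>i<k. a i * w i\<bar> \<le> B * w k + (\<Sum>i<k. B * (w i - w (Suc i)))"
    unfolding eq
  proof (rule order_trans[OF abs_triangle_ineq], rule add_mono)
    show "\<bar>(\<Sum>i<k. a i) * w k\<bar> \<le> B * w k"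
      using A[of k] nn[of k] by (simp add: abs_mult mult_right_mono)
    show "\<bar>\<Sum>i<k. (\<Sum>j<Suc i. a j) * (w i - w (Suc i))\<bar> \<le> (\<Sum>i<k. B * (w i - w (Suc i)))"
    proof (rule order_trans[OF sum_abs], rule sum_mono)
      fix i
      show "\<bar>(\<Sum>j<Suc i. a j) * (w i - w (Suc i))\<bar> \<le> B * (w i - w (Suc i))"
        unfolding abs_mult using A[of "Suc i"] dec[of i] by (intro mult_mono) auto
    qed
  qed
  also have "\<dots> = B * w 0"
    using sum_lessThan_telescope'[of "\<lambda>i. B * w i" k] by (simp add: right_diff_distrib)
  finally show ?thesis .
qed

lemma sum_inverse_sqrt_le: "(\<Sum>d\<in>{0<..y}. 1 / sqrt (real d)) \<le> 2 * sqrt (real y)"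
proof (induction y)
  case (Suc y)
  have "1 / sqrt (real (Suc y)) \<le> 2 * (sqrt (real (Suc y)) - sqrt (real y))"
  proof -
    have p: "sqrt (real (Suc y)) > 0" "sqrt (real y) \<ge> 0" "sqrt (real y) \<le> sqrt (real (Suc y))" by auto
    have "(sqrt (real (Suc y)) - sqrt (real y)) * (sqrt (real (Suc y)) + sqrt (real y)) = 1"
      by (simp add: algebra_simps)
    moreover have "(sqrt (real (Suc y)) - sqrt (real y)) * (sqrt (real (Suc y)) + sqrt (real y))
       \<le> (sqrt (real (Suc y)) - sqrt (real y)) * (2 * sqrt (real (Suc y)))"
      using p by (intro mult_left_mono) auto
    ultimately show ?thesis using p by (simp add: field_simps)
  qed
  moreover have "{0<..Suc y} = insert (Suc y) {0<..y}" by auto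
  ultimately show ?case using Suc by simp
qed simp

text \<open>Dirichlet's hyperbola method. The region splits into the square
  \<open>d, e \<le> y\<close> and two pieces in which one variable exceeds \<open>y\<close>. There
  the inner sum over the large variable is at most \<open>C / sqrt y\<close>, while the outer
  weights add up to at most \<open>2 * sqrt y\<close>, so \<open>y\<close> cancels.\<close>

lemma hyperbola_bound:
  fixes g h :: "nat \<Rightarrow> real"
  assumes g1: "\<And>n. n > 0 \<Longrightarrow> \<bar>g n\<bar> \<le> 1 / sqrt n" and h1: "\<And>n. n > 0 \<Longrightarrow> \<bar>h n\<bar> \<le> 1 / sqrt n"
    and gt: "\<And>u v. 0 < u \<Longrightarrow> \<bar>\<Sum>n\<in>{u<..v}. g n\<bar> \<le> C / sqrt u"
    and ht: "\<And>u v. 0 < u \<Longrightarrow> \<bar>\<Sum>n\<in>{u<..v}. h n\<bar> \<le> C / sqrt u"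
    and C: "C \<ge> 0" and y: "y > 0"
  shows "\<bar>\<Sum>(d,e)\<in>{(d,e). 0 < d \<and> 0 < e \<and> d * e \<le> y^2}. g d * h e\<bar> \<le> (1 + C)^2 + 4 * C"
proof -
  have init: "\<bar>\<Sum>n\<in>{0<..y}. f n\<bar> \<le> 1 + C"
    if "\<And>n. n > 0 \<Longrightarrow> \<bar>f n\<bar> \<le> 1 / sqrt n" "\<And>u v. 0 < u \<Longrightarrow> \<bar>\<Sum>n\<in>{u<..v}. f n\<bar> \<le> C / sqrt u"
    for f :: "nat \<Rightarrow> real"
  proof -
    have "{0<..y} = insert 1 {1<..y}" using y by auto
    then have "(\<Sum>n\<in>{0<..y}. f n) = f 1 + (\<Sum>n\<in>{1<..y}. f n)" by simp
    with that(1)[of 1] that(2)[of 1 y] show ?thesis by simp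
  qed
  have tail: "\<bar>\<Sum>d\<in>{0<..y}. f d * (\<Sum>e\<in>{y<..y^2 div d}. k e)\<bar> \<le> 2 * C"
    if f: "\<And>n. n > 0 \<Longrightarrow> \<bar>f n\<bar> \<le> 1 / sqrt n" and k: "\<And>u v. 0 < u \<Longrightarrow> \<bar>\<Sum>n\<in>{u<..v}. k n\<bar> \<le> C / sqrt u"
    for f k :: "nat \<Rightarrow> real"
  proof -
    have "\<bar>\<Sum>d\<in>{0<..y}. f d * (\<Sum>e\<in>{y<..y^2 div d}. k e)\<bar>
        \<le> (\<Sum>d\<in>{0<..y}. (1 / sqrt d) * (C / sqrt y))"
    proof (rule order_trans[OF sum_abs], rule sum_mono)
      fix d assume "d \<in> {0<..y}"
      then show "\<bar>f d * (\<Sum>e\<in>{y<..y^2 div d}. k e)\<bar> \<le> (1 / sqrt d) * (C / sqrt y)"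
        unfolding abs_mult using y C by (intro mult_mono f k) auto
    qed
    also have "\<dots> = (\<Sum>d\<in>{0<..y}. 1 / sqrt d) * (C / sqrt y)" by (simp only: sum_distrib_right)
    also have "\<dots> \<le> (2 * sqrt y) * (C / sqrt y)"
      using C by (intro mult_right_mono sum_inverse_sqrt_le) auto
    also have "\<dots> = 2 * C" using y by simp
    finally show ?thesis .
  qed
  let ?A = "{0<..y} \<times> {0<..y}"
  let ?B = "SIGMA d:{0<..y}. {y<..y^2 div d}"
  let ?C = "(\<lambda>(e,d). (d,e)) ` (SIGMA e:{0<..y}. {y<..y^2 div e})"
  let ?F = "\<lambda>(d,e). g d * h e"
  have le: "e \<le> y^2 div d \<longleftrightarrow> d * e \<le> y^2" if "d > 0" for d e :: nat
    using that by (simp add: less_eq_div_iff_mult_less_eq mult.commute)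
  have "{(d,e). 0 < d \<and> 0 < e \<and> d * e \<le> y^2} = ?A \<union> (?B \<union> ?C)" (is "?L = _")
  proof (intro subset_antisym subsetI)
    fix p assume "p \<in> ?L"
    then obtain d e where p: "p = (d,e)" "0 < d" "0 < e" "d * e \<le> y^2" by auto
    have "\<not> (y < d \<and> y < e)"
    proof
      assume "y < d \<and> y < e"
      then have "y * y < d * e" by (intro mult_strict_mono) auto
      with p show False by (simp add: power2_eq_square)
    qed
    then consider "d \<le> y" "e \<le> y" | "d \<le> y" "e > y" | "d > y" "e \<le> y" by linarith
    then show "p \<in> ?A \<union> (?B \<union> ?C)"
      using p by cases (auto simp: le image_iff mult.commute)
  next
    fix p assume "p \<in> ?A \<union> (?B \<union> ?C)"
    then show "p \<in> ?L"
    proof (elim UnE)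
      assume "p \<in> ?A"
      then show ?thesis by (auto simp: power2_eq_square intro: mult_mono)
    qed (auto simp: le mult.commute)
  qed
  moreover have "?A \<inter> (?B \<union> ?C) = {}" "?B \<inter> ?C = {}" by auto
  moreover have fin: "finite ?A" "finite ?B" "finite ?C" by auto
  ultimately have "sum ?F ?L = sum ?F ?A + (sum ?F ?B + sum ?F ?C)"
    by (simp add: sum.union_disjoint)
  moreover have "sum ?F ?A = (\<Sum>d\<in>{0<..y}. g d) * (\<Sum>e\<in>{0<..y}. h e)"
    by (simp add: sum_product sum.cartesian_product)
  moreover have "sum ?F ?B = (\<Sum>d\<in>{0<..y}. g d * (\<Sum>e\<in>{y<..y^2 div d}. h e))"
    by (simp add: sum.Sigma sum_distrib_left)
  moreover have "sum ?F ?C = (\<Sum>e\<in>{0<..y}. h e * (\<Sum>d\<in>{y<..y^2 div e}. g d))"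
  proof -
    have "sum ?F ?C = (\<Sum>(e,d)\<in>(SIGMA e:{0<..y}. {y<..y^2 div e}). g d * h e)"
      by (subst sum.reindex) (auto simp: inj_on_def o_def case_prod_unfold)
    then show ?thesis by (simp add: sum.Sigma sum_distrib_left mult.commute)
  qed
  moreover have "\<bar>(\<Sum>d\<in>{0<..y}. g d) * (\<Sum>e\<in>{0<..y}. h e)\<bar> \<le> (1 + C)^2"
    unfolding abs_mult power2_eq_square using C
    by (intro mult_mono init g1 gt h1 ht) auto
  moreover note tail[of g h, OF g1 ht] tail[of h g, OF h1 gt]
  ultimately show ?thesis by linarith
qed

section \<open>Real Dirichlet characters, their partial sums and divisor sums\<close>

locale real_character =
  fixes m :: nat and \<eta> :: "nat \<Rightarrow> real"
  assumes modulus_pos: "m > 0"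
    and mod_eq: "\<eta> (n mod m) = \<eta> n"
    and mult: "\<eta> (a * b) = \<eta> a * \<eta> b"
    and coprime_vals: "coprime n m \<Longrightarrow> \<eta> n = 1 \<or> \<eta> n = -1"
    and non_coprime: "\<not> coprime n m \<Longrightarrow> \<eta> n = 0"
begin

lemma cong_eq: "[a = b] (mod m) \<Longrightarrow> \<eta> a = \<eta> b"
  using mod_eq[of a] mod_eq[of b] by (simp add: cong_def)

lemma abs_le_1: "\<bar>\<eta> n\<bar> \<le> 1"
  using coprime_vals[of n] non_coprime[of n] by (cases "coprime n m") auto

lemma coprimeI: "\<eta> n \<noteq> 0 \<Longrightarrow> coprime n m"
  using non_coprime by blast

lemma one: "\<eta> 1 = 1"
  using mult[of 1 1] coprime_vals[of 1] by auto

lemma power: "\<eta> (a ^ k) = \<eta> a ^ k"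
  by (induction k) (use one in \<open>auto simp: mult\<close>)

text \<open>Multiplication by \<open>a\<close> permutes the residues modulo \<open>m\<close> and
  negates \<open>\<eta>\<close>, so the sum over all residues equals its own negative. Periodicity
  then slides the window.\<close>

lemma sum_period:
  assumes "\<eta> a = -1"
  shows "(\<Sum>n\<in>{u..<u+m}. \<eta> n) = 0"
proof (induction u)
  case 0
  have co: "coprime a m" using assms by (intro coprimeI) auto
  have inj: "inj_on (\<lambda>n. a * n mod m) {..<m}"
  proof (rule inj_onI)
    fix x y assume "x \<in> {..<m}" "y \<in> {..<m}" "a * x mod m = a * y mod m"
    then have "[x = y] (mod m)" using co by (metis cong_def cong_mult_lcancel_nat)
    then show "x = y" using \<open>x \<in> _\<close> \<open>y \<in> _\<close> by (simp add: cong_def)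
  qed
  have "(\<lambda>n. a * n mod m) ` {..<m} = {..<m}"
    using modulus_pos by (intro card_subset_eq) (auto simp: card_image[OF inj])
  then have "(\<Sum>n<m. \<eta> n) = (\<Sum>n<m. \<eta> (a * n mod m))"
    using sum.reindex[OF inj, of \<eta>] by (simp add: o_def)
  also have "\<dots> = - (\<Sum>n<m. \<eta> n)" by (simp add: mod_eq mult assms sum_negf)
  finally show ?case by (simp add: atLeast0LessThan)
next
  case (Suc u)
  have "\<eta> (u + m) = \<eta> u" by (intro cong_eq) (simp add: cong_def)
  moreover have "(\<Sum>n\<in>{u..<Suc u+m}. \<eta> n) = (\<Sum>n\<in>{u..<u+m}. \<eta> n) + \<eta> (u + m)" by simp
  moreover have "(\<Sum>n\<in>{u..<Suc u+m}. \<eta> n) = \<eta> u + (\<Sum>n\<in>{Suc u..<Suc u+m}. \<eta> n)"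
    by (subst sum.atLeast_Suc_lessThan) auto
  ultimately show ?case using Suc by simp
qed

text \<open>Complete periods cancel, and fewer than \<open>m\<close> terms of absolute value at most
  1 remain.\<close>

lemma partial_sum_bound:
  assumes "\<eta> a = -1"
  shows "\<bar>\<Sum>i<k. \<eta> (u + i)\<bar> \<le> m"
proof (induction k arbitrary: u rule: less_induct)
  case (less k)
  show ?case
  proof (cases "k < m")
    case True
    have "\<bar>\<Sum>i<k. \<eta> (u + i)\<bar> \<le> (\<Sum>i<k. 1)"
      by (rule order_trans[OF sum_abs], rule sum_mono) (rule abs_le_1)
    with True show ?thesis by simp
  next
    case False
    have "(\<Sum>i<k. \<eta> (u + i)) = (\<Sum>i\<in>{0..<m}. \<eta> (u + i)) + (\<Sum>i\<in>{m..<k}. \<eta> (u + i))"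
      using False by (subst sum.atLeastLessThan_concat) (auto simp: atLeast0LessThan)
    also have "(\<Sum>i\<in>{0..<m}. \<eta> (u + i)) = (\<Sum>n\<in>{u..<u+m}. \<eta> n)"
      using sum.shift_bounds_nat_ivl[of \<eta> 0 u m] by (simp add: add.commute)
    also have "(\<Sum>i\<in>{m..<k}. \<eta> (u + i)) = (\<Sum>i<k-m. \<eta> ((u + m) + i))"
      using sum.shift_bounds_nat_ivl[of "\<lambda>i. \<eta> (u + i)" 0 m "k - m"] False
      by (simp add: atLeast0LessThan add_ac)
    finally show ?thesis using less[of "k - m" "u + m"] False modulus_pos sum_period[OF assms, of u] by simp
  qed
qed

lemma tail_bound:
  assumes "\<eta> a = -1" "u > 0"
  shows "\<bar>\<Sum>n\<in>{u<..v}. \<eta> n / sqrt n\<bar> \<le> m / sqrt u"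
proof -
  have "{u<..v} = (\<lambda>i. Suc u + i) ` {..<v - u}"
  proof (intro subset_antisym subsetI)
    fix x assume "x \<in> {u<..v}"
    then show "x \<in> (\<lambda>i. Suc u + i) ` {..<v - u}" by (intro image_eqI[of _ _ "x - Suc u"]) auto
  qed auto
  then have "(\<Sum>n\<in>{u<..v}. \<eta> n / sqrt n) = (\<Sum>i<v-u. \<eta> (Suc u + i) * (1 / sqrt (real (Suc u + i))))"
    by (simp only:, subst sum.reindex) (auto simp: inj_on_def)
  also have "\<bar>\<dots>\<bar> \<le> m * (1 / sqrt (real (Suc u + 0)))"
  proof (rule abel_bound)
    show "\<bar>\<Sum>i<j. \<eta> (Suc u + i)\<bar> \<le> m" for j by (rule partial_sum_bound[OF assms(1)])
  qed (auto intro!: divide_left_mono)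
  also have "\<dots> \<le> m / sqrt u" using assms(2) by (auto intro!: divide_left_mono)
  finally show ?thesis .
qed

text \<open>Passing from \<open>k\<close> to \<open>Suc k\<close>, the new divisors are exactly
  \<open>p ^ Suc k * d\<close> with \<open>d\<close> dividing \<open>n\<close>.\<close>

lemma sum_divisors_prime_power_mult:
  assumes p: "prime p" "\<not> p dvd n" and n: "n > 0"
  shows "(\<Sum>d | d dvd p^k * n. \<eta> d) = (\<Sum>i\<le>k. \<eta> p ^ i) * (\<Sum>d | d dvd n. \<eta> d)"
proof (induction k)
  case (Suc k)
  have p0: "p > 0" using p(1) prime_gt_0_nat by blast
  have split: "{d. d dvd p ^ Suc k * n} = {d. d dvd p ^ k * n} \<union> (\<lambda>d. p ^ Suc k * d) ` {d. d dvd n}"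
  proof (intro subset_antisym subsetI)
    fix d assume d: "d \<in> {d. d dvd p ^ Suc k * n}"
    then obtain j d' where jd: "d = d' * p ^ j" "\<not> p dvd d'"
      using prime_power_canonical[OF p(1), of d] n p0
      by (metis dvd_pos_nat mem_Collect_eq nat_0_less_mult_iff zero_less_power)
    have "d' dvd p ^ Suc k * n" using d jd by (metis dvd_mult_left mem_Collect_eq)
    moreover have "coprime d' (p ^ Suc k)" using prime_imp_coprime[OF p(1) jd(2)]
      by (metis coprime_commute coprime_power_right_iff)
    ultimately have dn: "d' dvd n" by (simp add: coprime_dvd_mult_right_iff)
    have "p ^ j dvd p ^ Suc k * n" using d jd by (metis dvd_mult_right mem_Collect_eq)
    moreover have "coprime (p ^ j) n" using p by (simp add: prime_imp_coprime)
    ultimately have "p ^ j dvd p ^ Suc k" by (simp add: coprime_dvd_mult_left_iff)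
    then have "j \<le> Suc k" using p(1) by (meson dvd_power_iff_le prime_ge_2_nat)
    then consider "j = Suc k" | "j \<le> k" by linarith
    then show "d \<in> {d. d dvd p ^ k * n} \<union> (\<lambda>d. p ^ Suc k * d) ` {d. d dvd n}"
    proof cases
      case 1
      then show ?thesis using jd(1) dn by (auto simp: mult.commute)
    next
      case 2
      then have "d dvd p ^ k * n" unfolding jd(1)
        using mult_dvd_mono[OF le_imp_power_dvd[OF 2, of p] dn] by (simp add: mult.commute)
      then show ?thesis by simp
    qed
  qed (auto simp: mult.assoc intro: dvd_mult)
  have disj: "{d. d dvd p ^ k * n} \<inter> (\<lambda>d. p ^ Suc k * d) ` {d. d dvd n} = {}"
  proof -
    have False if "p ^ Suc k * d dvd p ^ k * n" for d
    proof -
      have "p ^ k * p dvd p ^ k * n" using that by (metis dvd_mult_left power_Suc2)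
      then show False using p p0 by simp
    qed
    then show ?thesis by blast
  qed
  have "inj_on (\<lambda>d. p ^ Suc k * d) {d. d dvd n}" using p0 by (auto simp: inj_on_def)
  then have "(\<Sum>d\<in>(\<lambda>d. p ^ Suc k * d) ` {d. d dvd n}. \<eta> d) = \<eta> p ^ Suc k * (\<Sum>d | d dvd n. \<eta> d)"
    by (simp only: sum.reindex o_def mult power sum_distrib_left)
  then show ?case unfolding split using n p0 disj Suc
    by (subst sum.union_disjoint) (auto simp: algebra_simps)
qed simp

text \<open>The divisor sum is a product of local factors: \<open>k + 1\<close> if
  \<open>\<eta> p = 1\<close>, the indicator of even \<open>k\<close> if
  \<open>\<eta> p = -1\<close>, and 1 if \<open>p\<close> divides \<open>m\<close>. A factor with
  \<open>\<eta> p = -1\<close> is nonzero only for even \<open>k\<close>, where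
  \<open>\<psi> p ^ k = 1\<close>; hence \<open>\<psi> n = 1\<close> wherever the sum is nonzero and
  \<open>n\<close> is prime to \<open>m\<close>.\<close>

lemma sum_divisors_properties:
  assumes "real_character m \<psi>"
    and imp: "\<And>p. prime p \<Longrightarrow> coprime p m \<Longrightarrow> \<eta> p = 1 \<Longrightarrow> \<psi> p = 1"
    and "n > 0"
  shows "(\<Sum>d | d dvd n. \<eta> d) \<ge> 0 \<and> (coprime n m \<longrightarrow> \<psi> n * (\<Sum>d | d dvd n. \<eta> d) = (\<Sum>d | d dvd n. \<eta> d))
    \<and> ((\<exists>k. n = k^2) \<longrightarrow> (\<Sum>d | d dvd n. \<eta> d) \<ge> 1)"
  using \<open>n > 0\<close>
proof (induction n rule: less_induct)
  case (less n)
  interpret \<psi>: real_character m \<psi> by fact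
  show ?case
  proof (cases "n = 1")
    case True
    then show ?thesis using one \<psi>.one by simp
  next
    case False
    then obtain p where p: "prime p" "p dvd n" using prime_factor_nat by blast
    obtain k n' where k: "n = n' * p ^ k" "\<not> p dvd n'"
      using prime_power_canonical[OF p(1) less.prems] by blast
    have n': "n' > 0" using k less.prems by (auto intro!: Nat.gr0I)
    have k0: "k > 0" using k p by (auto intro!: Nat.gr0I)
    have "n' < n" using k(1) n' one_less_power[OF prime_gt_1_nat[OF p(1)] k0] by simp
    note IH = less.IH[OF this n']
    let ?r = "\<lambda>n. \<Sum>d | d dvd n. \<eta> d"
    let ?s = "\<Sum>i\<le>k. \<eta> p ^ i"
    have r: "?r n = ?s * ?r n'"
      using sum_divisors_prime_power_mult[OF p(1) k(2) n', of k] k(1) by (simp add: mult.commute)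
    have alt: "(\<Sum>i\<le>j. (-1::real) ^ i) = (if even j then 1 else 0)" for j
      by (induction j) auto
    have s: "?s \<ge> 0 \<and> (even k \<longrightarrow> ?s \<ge> 1) \<and> (coprime p m \<longrightarrow> \<psi> p ^ k * ?s = ?s)"
    proof (cases "coprime p m")
      case True
      with coprime_vals[OF this] \<psi>.coprime_vals[OF this] imp[OF p(1) this] show ?thesis
        by (auto simp: alt)
    next
      case False
      then show ?thesis using non_coprime[OF False] by (simp add: power_0_left)
    qed
    have "\<psi> n * ?r n = ?r n" if "coprime n m"
    proof -
      have "coprime n' m" "coprime p m" using that k(1) k0 by auto
      then show ?thesis using r s IH k(1) \<open>coprime n m\<close> by (auto simp: \<psi>.mult \<psi>.power)
    qed
    moreover have "?r n \<ge> 1" if "n = j^2" for j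
    proof -
      have "j > 0" using that less.prems by (auto intro!: Nat.gr0I)
      then obtain i j' where i: "j = j' * p ^ i" "\<not> p dvd j'"
        using prime_power_canonical[OF p(1)] by blast
      have p0: "p > 0" using p(1) prime_gt_0_nat by blast
      have eq: "n' * p ^ k = j'^2 * p ^ (2 * i)"
        using that k(1) i(1) by (simp add: power_mult_distrib power_mult[symmetric] mult.commute)
      have "multiplicity p (n' * p ^ k) = k"
        using k(2) p(1) n' by (intro multiplicity_eqI) auto
      moreover have "multiplicity p (j'^2 * p ^ (2 * i)) = 2 * i"
        using i(2) p(1) \<open>j > 0\<close> by (intro multiplicity_eqI) (auto simp: prime_dvd_power_iff)
      ultimately have ki: "k = 2 * i" using eq by simp
      then have ev: "even k" and "n' = j'^2" using eq p0 by auto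
      then have "?r n' \<ge> 1" using IH by blast
      then show ?thesis using s ev r mult_mono[of 1 ?s 1 "?r n'"] by auto
    qed
    ultimately show ?thesis using r s IH by auto
  qed
qed

end

section \<open>Split primes and characters\<close>

text \<open>The values at \<open>a\<close> and \<open>b\<close> make \<open>\<psi>\<close> and
  \<open>\<psi> \<eta>\<close> nonprincipal, so both have small weighted tails and the hyperbola
  bound applies. Without such a prime, \<open>f\<close> below is nonnegative and at least
  \<open>1 / k\<close> at \<open>k^2\<close> for \<open>k\<close> prime to \<open>m\<close>, and the
  harmonic series would converge.\<close>

lemma exists_prime_separating_characters:
  assumes chi: "real_character m \<eta>" and psi: "real_character m \<psi>"
    and a: "\<psi> a = -1" and b: "\<psi> b * \<eta> b = -1"
  shows "\<exists>p. prime p \<and> \<eta> p = 1 \<and> \<psi> p = -1"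
proof (rule ccontr)
  assume neg: "\<not> ?thesis"
  interpret \<eta>: real_character m \<eta> by fact
  interpret \<psi>: real_character m \<psi> by fact
  interpret \<phi>: real_character m "\<lambda>n. \<psi> n * \<eta> n"
  proof
    fix n :: nat
    show "coprime n m \<Longrightarrow> \<psi> n * \<eta> n = 1 \<or> \<psi> n * \<eta> n = -1"
      using \<eta>.coprime_vals[of n] \<psi>.coprime_vals[of n] by auto
    show "\<psi> (n mod m) * \<eta> (n mod m) = \<psi> n * \<eta> n"
      by (simp only: \<eta>.mod_eq \<psi>.mod_eq)
    show "\<not> coprime n m \<Longrightarrow> \<psi> n * \<eta> n = 0" using \<eta>.non_coprime by simp
    show "m > 0" by (rule \<eta>.modulus_pos)
    show "\<psi> (n * k) * \<eta> (n * k) = \<psi> n * \<eta> n * (\<psi> k * \<eta> k)" for k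
      by (simp only: \<eta>.mult \<psi>.mult ac_simps)
  qed
  have imp: "\<psi> p = 1" if "prime p" "coprime p m" "\<eta> p = 1" for p
    using that neg \<psi>.coprime_vals[of p] by blast
  define r where "r = (\<lambda>n. \<Sum>d | d dvd n. \<eta> d)"
  have props: "r n \<ge> 0 \<and> (coprime n m \<longrightarrow> \<psi> n * r n = r n) \<and> ((\<exists>k. n = k^2) \<longrightarrow> r n \<ge> 1)"
    if "n > 0" for n
    unfolding r_def by (rule \<eta>.sum_divisors_properties) (use psi imp that in blast)+
  have r_nonneg: "r n \<ge> 0" if "n > 0" for n using props that by blast
  have r_coprime: "\<psi> n * r n = r n" if "n > 0" "coprime n m" for n using props that by blast
  have r_square: "r (k^2) \<ge> 1" if "k > 0" for k
    using props[of "k^2"] that by (metis zero_less_power)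
  define f where "f = (\<lambda>n. \<psi> n * r n / sqrt n)"
  define B where "B = (1 + real m)^2 + 4 * real m"
  have f_nonneg: "f n \<ge> 0" for n
    using r_nonneg[of n] r_coprime[of n] \<psi>.non_coprime[of n] by (cases "n = 0"; cases "coprime n m") (auto simp: f_def)
  have f_square: "f (k^2) \<ge> 1 / k" if "coprime k m" "k > 0" for k
    using r_coprime[of "k^2"] r_square[of k] that by (simp add: f_def divide_right_mono)
  \<comment> \<open>Complete multiplicativity of \<open>\<psi>\<close> makes \<open>f\<close> the
    convolution of \<open>?g\<close> and \<open>?h\<close>, so its sum up to \<open>y^2\<close> runs
    over the hyperbolic region; the tail constant is \<open>m\<close>.\<close>
  have upper: "(\<Sum>n\<in>{0<..y^2}. f n) \<le> B" if y: "y > 0" for y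
  proof -
    let ?L = "{(d,e). 0 < d \<and> 0 < e \<and> d * e \<le> y^2}"
    let ?g = "\<lambda>n. \<psi> n / sqrt n" and ?h = "\<lambda>n. \<psi> n * \<eta> n / sqrt n"
    have "(\<Sum>n\<in>{0<..y^2}. f n) = (\<Sum>n\<in>{0<..y^2}. \<Sum>e | e dvd n. ?g (n div e) * ?h e)"
    proof (rule sum.cong[OF refl])
      fix n assume "n \<in> {0<..y^2}"
      have "?g (n div e) * ?h e = \<psi> n / sqrt n * \<eta> e" if "e dvd n" for e
        using that by (elim dvdE) (use \<open>n \<in> _\<close> in \<open>auto simp: \<psi>.mult real_sqrt_mult mult_ac\<close>)
      then show "f n = (\<Sum>e | e dvd n. ?g (n div e) * ?h e)"
        by (simp add: f_def r_def sum_distrib_left sum_divide_distrib)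
    qed
    also have "\<dots> = (\<Sum>(n,e)\<in>(SIGMA n:{0<..y^2}. {e. e dvd n}). ?g (n div e) * ?h e)"
      by (rule sum.Sigma) auto
    also have "\<dots> = (\<Sum>(d,e)\<in>?L. ?g d * ?h e)"
      by (rule sum.reindex_bij_witness[of _ "\<lambda>(d,e). (d*e,e)" "\<lambda>(n,e). (n div e, e)"])
         (auto elim!: dvdE simp: mult_ac)
    also have "\<dots> \<le> B"
    proof -
      have "\<bar>\<Sum>(d,e)\<in>?L. ?g d * ?h e\<bar> \<le> B" unfolding B_def
      proof (rule hyperbola_bound)
        show "\<bar>\<psi> n / sqrt n\<bar> \<le> 1 / sqrt n" for n
          using \<psi>.abs_le_1[of n] by (auto simp: abs_divide intro: divide_right_mono)
        show "\<bar>\<psi> n * \<eta> n / sqrt n\<bar> \<le> 1 / sqrt n" for n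
          using \<phi>.abs_le_1[of n] by (auto simp: abs_divide intro: divide_right_mono)
      qed (use \<psi>.tail_bound[OF a] \<phi>.tail_bound[OF b] y in auto)
      then show ?thesis by linarith
    qed
    finally show ?thesis .
  qed
  have "(\<Sum>j<J. 1 / real (Suc j)) \<le> m * B" for J
  proof (cases "J = 0")
    case False
    \<comment> \<open>These integers are distinct, prime to \<open>m\<close> and at most
      \<open>m * Suc j\<close>; their squares alone contribute \<open>1 / m\<close> times the
      harmonic series.\<close>
    let ?k = "\<lambda>j. 1 + j * m"
    have m: "m > 0" by (rule \<eta>.modulus_pos)
    have "(\<Sum>j<J. 1 / real (Suc j)) \<le> (\<Sum>j<J. m * f ((?k j)^2))"
    proof (rule sum_mono)
      fix j
      have "coprime (?k j) m"
        using gcd_add_mult[of m j 1] by (metis add.commute coprime_iff_gcd_eq_1 gcd.commute gcd_1_nat One_nat_def)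
      then have "1 / real (?k j) \<le> f ((?k j)^2)" by (intro f_square) auto
      then have "m * (1 / real (?k j)) \<le> m * f ((?k j)^2)" by (intro mult_left_mono) auto
      moreover have "1 / real (Suc j) \<le> m * (1 / real (?k j))"
      proof -
        have "?k j \<le> m * Suc j" using m by simp
        then have le: "real (?k j) \<le> real m * real (Suc j)" by (metis of_nat_le_iff of_nat_mult)
        have frac: "1 / b \<le> c * (1 / d)" if "d \<le> c * b" "0 < d" "0 < b" for b c d :: real
          using that by (simp add: field_simps)
        show ?thesis by (rule frac[OF le]) (simp_all add: add_pos_nonneg)
      qed
      ultimately show "1 / real (Suc j) \<le> m * f ((?k j)^2)" by linarith
    qed
    also have "\<dots> = m * (\<Sum>n\<in>(\<lambda>j. (?k j)^2) ` {..<J}. f n)"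
      using m by (subst sum.reindex) (auto simp: inj_on_def sum_distrib_left power2_eq_iff_nonneg)
    also have "\<dots> \<le> m * (\<Sum>n\<in>{0<..(J * m)^2}. f n)"
    proof (intro mult_left_mono sum_mono2)
      have "?k j \<le> J * m" if "j < J" for j
      proof -
        have "Suc j * m \<le> J * m" using that by (intro mult_right_mono) auto
        then show ?thesis using m by simp
      qed
      then show "(\<lambda>j. (?k j)^2) ` {..<J} \<subseteq> {0<..(J * m)^2}" by (auto intro!: power_mono)
    qed (use f_nonneg in auto)
    also have "\<dots> \<le> m * B" using False m by (intro mult_left_mono upper) auto
    finally show ?thesis .
  qed (simp add: B_def)
  then have "summable (\<lambda>j. 1 / real (Suc j))"
    by (intro summableI_nonneg_bounded) auto
  then show False
    using not_summable_harmonic[where 'a=real] summable_Suc_iff[of "\<lambda>n. 1 / real n"]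
    by (simp add: inverse_eq_divide)
qed

text \<open>If the claim fails, take a largest subgroup of the units that contains all squares and
  split primes but not \<open>a\<close>. Modulo squares the units form an elementary abelian
  2-group, so this subgroup has index two, and the character with this kernel contradicts the
  separation of characters by primes.\<close>

theorem exists_split_product_in_square_coset:
  assumes chi: "real_character m \<eta>" and a: "\<eta> a = 1"
  shows "\<exists>c s. c > 0 \<and> (\<forall>p. prime p \<longrightarrow> p dvd c \<longrightarrow> \<eta> p = 1) \<and> coprime s m \<and> [c * s^2 = a] (mod m)"
proof (rule ccontr)
  assume neg: "\<not> ?thesis"
  interpret \<eta>: real_character m \<eta> by fact
  have co_a: "coprime a m" using a by (intro \<eta>.coprimeI) auto
  \<comment> \<open>Such sets are preimages of subgroups of the units modulo \<open>m\<close>.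
    Closure under inverses follows: the inverse of \<open>x\<close> is \<open>x\<close> times the
    square of an inverse.\<close>
  define good where "good = (\<lambda>T. (\<forall>n\<in>T. coprime n m) \<and> (\<forall>x\<in>T. \<forall>y\<in>T. x * y \<in> T)
      \<and> (\<forall>x\<in>T. \<forall>y. [x = y] (mod m) \<longrightarrow> y \<in> T) \<and> (\<forall>s. coprime s m \<longrightarrow> s^2 \<in> T)
      \<and> (\<forall>p. prime p \<longrightarrow> \<eta> p = 1 \<longrightarrow> p \<in> T) \<and> a \<notin> T)"
  define S where "S = {n. \<exists>c s. c > 0 \<and> (\<forall>p. prime p \<longrightarrow> p dvd c \<longrightarrow> \<eta> p = 1) \<and> coprime s m \<and> [c * s^2 = n] (mod m)}"
  have cop: "coprime c m" if "c > 0" "\<forall>p. prime p \<longrightarrow> p dvd c \<longrightarrow> \<eta> p = 1" for c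
  proof (rule ccontr)
    assume "\<not> coprime c m"
    then have "gcd c m \<noteq> 1" unfolding coprime_iff_gcd_eq_1 .
    then obtain p where p: "prime p" "p dvd gcd c m" using prime_factor_nat by blast
    then have pcm: "p dvd c" "p dvd m" by simp_all
    then have "\<eta> p = 1" using that(2) p(1) by blast
    then have "coprime p m" by (intro \<eta>.coprimeI) simp
    then have "is_unit p" using coprime_common_divisor[OF _ dvd_refl pcm(2)] by blast
    then show False using p(1) by auto
  qed
  have "good S"
    unfolding good_def
  proof (intro conjI ballI allI impI)
    fix n assume "n \<in> S"
    then obtain c s where *: "c > 0" "\<forall>p. prime p \<longrightarrow> p dvd c \<longrightarrow> \<eta> p = 1" "coprime s m" "[c * s^2 = n] (mod m)"
      by (auto simp: S_def)
    have "coprime (c * s^2) m" using cop[OF *(1,2)] *(3) by simp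
    then show "coprime n m" using *(4) using cong_imp_coprime by blast
  next
    fix x y assume "x \<in> S" "y \<in> S"
    then obtain c s c' s' where *: "c > 0" "\<forall>p. prime p \<longrightarrow> p dvd c \<longrightarrow> \<eta> p = 1" "coprime s m" "[c * s^2 = x] (mod m)"
       "c' > 0" "\<forall>p. prime p \<longrightarrow> p dvd c' \<longrightarrow> \<eta> p = 1" "coprime s' m" "[c' * s'^2 = y] (mod m)"
      by (auto simp: S_def)
    have "[(c * c') * (s * s')^2 = x * y] (mod m)"
      using cong_mult[OF *(4) *(8)] by (simp add: power_mult_distrib ac_simps)
    moreover have "\<forall>p. prime p \<longrightarrow> p dvd c * c' \<longrightarrow> \<eta> p = 1"
      using *(2,6) by (auto simp: prime_dvd_mult_iff)
    moreover have "c * c' > 0" "coprime (s * s') m" using * by auto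
    ultimately show "x * y \<in> S" unfolding S_def by blast
  next
    fix x y assume "x \<in> S" "[x = y] (mod m)"
    then show "y \<in> S" unfolding S_def using cong_trans by blast
  next
    fix s assume "coprime s m"
    moreover have "\<forall>p. prime p \<longrightarrow> p dvd 1 \<longrightarrow> \<eta> p = 1" by auto
    moreover have "[1 * s^2 = s^2] (mod m)" by simp
    ultimately show "s^2 \<in> S" unfolding S_def using zero_less_one by blast
  next
    fix p assume p: "prime (p::nat)" "\<eta> p = 1"
    then have "\<forall>q. prime q \<longrightarrow> q dvd p \<longrightarrow> \<eta> q = 1"
      using primes_dvd_imp_eq by blast
    moreover have "p > 0" "coprime 1 m" "[p * 1^2 = p] (mod m)" using p prime_gt_0_nat by auto
    ultimately show "p \<in> S" unfolding S_def by blast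
  next
    show "a \<notin> S" using neg by (auto simp: S_def)
  qed
  \<comment> \<open>The number of residues in a good set is at most \<open>m\<close>, so a largest
    good set exists; \<open>S\<close> shows that there is one at all.\<close>
  define weight where "weight = (\<lambda>T. card (T \<inter> {..<m}))"
  have "\<exists>T. good T \<and> (\<forall>T'. good T' \<longrightarrow> weight T' \<le> weight T)"
  proof -
    have "\<forall>T. good T \<longrightarrow> weight T < Suc m"
      unfolding weight_def using card_mono[of "{..<m}" "_ \<inter> {..<m}"] by (simp add: less_Suc_eq_le)
    then show ?thesis using ex_has_greatest_nat[where P = good and f = weight and k = S] \<open>good S\<close> by blast
  qed
  then obtain T where T: "good T" and maxT: "\<And>T'. good T' \<Longrightarrow> weight T' \<le> weight T" by blast
  have T_co: "coprime n m" if "n \<in> T" for n using T that unfolding good_def by blast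
  have T_mult: "x * y \<in> T" if "x \<in> T" "y \<in> T" for x y using T that unfolding good_def by blast
  have T_cong: "y \<in> T" if "x \<in> T" "[x = y] (mod m)" for x y using T that unfolding good_def by blast
  have T_sq: "s^2 \<in> T" if "coprime s m" for s using T that unfolding good_def by blast
  have T_pr: "p \<in> T" if "prime p" "\<eta> p = 1" for p using T that unfolding good_def by blast
  have T_a: "a \<notin> T" using T unfolding good_def by blast
  have T_cancel: "y \<in> T" if xy: "x \<in> T" "x * y \<in> T" for x y
  proof -
    obtain v where v: "[x * v = 1] (mod m)" using cong_solve_coprime_nat[OF T_co[OF xy(1)]] by auto
    then have "coprime (x * v) m" using cong_imp_coprime[OF cong_sym[OF v]] by simp
    then have "v^2 * (x * (x * y)) \<in> T" using T_sq[of v] xy T_mult by auto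
    moreover have "[v^2 * (x * (x * y)) = 1 * 1 * y] (mod m)"
      using cong_mult[OF cong_mult[OF v v] cong_refl[of y]] by (simp add: power2_eq_square ac_simps)
    ultimately show ?thesis using T_cong by simp
  qed
  \<comment> \<open>Adjoining the coset of \<open>u\<close> to \<open>T\<close> gives a larger good
    set unless that coset contains \<open>a\<close>. Since \<open>u^2\<close> lies in
    \<open>T\<close>, this places \<open>u * a\<close> in \<open>T\<close>.\<close>
  have T_coset: "u * a \<in> T" if u: "coprime u m" "u \<notin> T" for u
  proof -
    define T' where "T' = {n. n \<in> T \<or> (\<exists>t\<in>T. [n = u * t] (mod m))}"
    have "a \<in> T'"
    proof (rule ccontr)
      assume "a \<notin> T'"
      have uu: "u * t * (u * t') \<in> T" if "t \<in> T" "t' \<in> T" for t t'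
        using T_mult[OF T_sq[OF u(1)] T_mult[OF that]] by (simp add: power2_eq_square ac_simps)
      have "good T'"
        unfolding good_def
      proof (intro conjI ballI allI impI)
        fix n assume "n \<in> T'"
        then consider "n \<in> T" | t where "t \<in> T" "[n = u * t] (mod m)" by (auto simp: T'_def)
        then show "coprime n m"
        proof cases
          case 2
          then have "coprime (u * t) m" using u(1) T_co by auto
          then show ?thesis using 2 cong_imp_coprime cong_sym by blast
        qed (rule T_co)
      next
        fix x y assume "x \<in> T'" "y \<in> T'"
        then consider "x \<in> T" "y \<in> T" | t where "x \<in> T" "t \<in> T" "[y = u * t] (mod m)"
          | t where "y \<in> T" "t \<in> T" "[x = u * t] (mod m)"
          | t t' where "t \<in> T" "[x = u * t] (mod m)" "t' \<in> T" "[y = u * t'] (mod m)"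
          by (auto simp: T'_def)
        then show "x * y \<in> T'"
        proof cases
          case 1
          then show ?thesis using T_mult by (auto simp: T'_def)
        next
          case 2
          then have "[x * y = u * (x * t)] (mod m)" using cong_mult[OF cong_refl[of x] 2(3)] by (simp add: ac_simps)
          then show ?thesis using T_mult[OF 2(1,2)] by (auto simp: T'_def)
        next
          case 3
          then have "[x * y = u * (y * t)] (mod m)" using cong_mult[OF 3(3) cong_refl[of y]] by (simp add: ac_simps)
          then show ?thesis using T_mult[OF 3(1,2)] by (auto simp: T'_def)
        next
          case 4
          then have "[u * t * (u * t') = x * y] (mod m)" using cong_mult[OF 4(2,4)] cong_sym by blast
          then show ?thesis using T_cong[OF uu[OF 4(1,3)]] by (auto simp: T'_def)
        qed
      next
        fix x y assume "x \<in> T'" "[x = y] (mod m)"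
        then show "y \<in> T'" unfolding T'_def using T_cong cong_trans cong_sym by blast
      qed (use T_sq T_pr \<open>a \<notin> T'\<close> in \<open>auto simp: T'_def\<close>)
      then have "card (T' \<inter> {..<m}) \<le> card (T \<inter> {..<m})" using maxT by (simp add: weight_def)
      moreover have "T \<inter> {..<m} \<subseteq> T' \<inter> {..<m}" by (auto simp: T'_def)
      ultimately have "T \<inter> {..<m} = T' \<inter> {..<m}" by (intro card_subset_eq card_seteq) auto
      moreover have "u mod m \<in> T' \<inter> {..<m}"
        using T_sq[of 1] \<eta>.modulus_pos by (auto simp: T'_def cong_def intro!: bexI[of _ 1])
      ultimately have "u mod m \<in> T" by blast
      then have "u \<in> T" using T_cong[of "u mod m" u] by (simp add: cong_def)
      with u show False by simp
    qed
    then obtain t where t: "t \<in> T" "[a = u * t] (mod m)" using T_a by (auto simp: T'_def)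
    have "[u^2 * t = u * a] (mod m)"
      using cong_mult[OF cong_refl[of u] cong_sym[OF t(2)]] by (simp add: power2_eq_square ac_simps)
    then show ?thesis using T_cong T_mult[OF T_sq[OF u(1)] t(1)] by blast
  qed
  define \<psi> :: "nat \<Rightarrow> real" where "\<psi> = (\<lambda>n. if coprime n m then (if n \<in> T then 1 else -1) else 0)"
  have "real_character m \<psi>"
  proof
    show "m > 0" by (rule \<eta>.modulus_pos)
    show "\<psi> (n mod m) = \<psi> n" for n
    proof -
      have "n mod m \<in> T \<longleftrightarrow> n \<in> T" using T_cong[of n "n mod m"] T_cong[of "n mod m" n] by (auto simp: cong_def)
      moreover have "coprime (n mod m) m \<longleftrightarrow> coprime n m" using \<eta>.modulus_pos by simp
      ultimately show ?thesis by (simp add: \<psi>_def)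
    qed
    show "\<psi> (x * y) = \<psi> x * \<psi> y" for x y
    proof (cases "coprime x m \<and> coprime y m")
      case True
      have "x * y \<in> T" if "x \<notin> T" "y \<notin> T"
      proof -
        have "x * a * (y * a) \<in> T" using T_coset that True T_mult by blast
        then have "a^2 * (x * y) \<in> T" by (simp add: power2_eq_square ac_simps)
        then show ?thesis using T_cancel T_sq[OF co_a] by blast
      qed
      moreover have "y \<in> T" if "x \<in> T" "x * y \<in> T" using T_cancel that by blast
      moreover have "x \<in> T" if "y \<in> T" "x * y \<in> T" using T_cancel[of y x] that by (metis mult.commute)
      ultimately have "x * y \<in> T \<longleftrightarrow> (x \<in> T \<longleftrightarrow> y \<in> T)" using T_mult[of x y] by blast
      then show ?thesis using True by (simp add: \<psi>_def)
    qed (auto simp: \<psi>_def)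
  qed (auto simp: \<psi>_def)
  moreover have "\<psi> a = -1" using co_a T_a by (simp add: \<psi>_def)
  \<comment> \<open>Because \<open>\<eta> a = 1\<close>, the one element \<open>a\<close> certifies
    that both \<open>\<psi>\<close> and \<open>\<psi> \<eta>\<close> are nonprincipal.\<close>
  ultimately obtain p where p: "prime p" "\<eta> p = 1" "\<psi> p = -1"
    using exists_prime_separating_characters[OF chi, of \<psi> a a] a by auto
  then show False using T_pr[OF p(1,2)] by (auto simp: \<psi>_def split: if_splits)
qed

section \<open>The quadratic character of \<open>-5 N\<close>\<close>

lemma Legendre_cong: "[a = b] (mod p) \<Longrightarrow> Legendre a p = Legendre b p"
proof -
  assume c: "[a = b] (mod p)"
  have "[x = a] (mod p) \<longleftrightarrow> [x = b] (mod p)" for x using c cong_trans cong_sym by blast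
  then show ?thesis unfolding Legendre_def QuadRes_def by (simp add: cong_sym_eq[of _ 0])
qed

lemma Legendre_eq_0_iff: "Legendre a p = 0 \<longleftrightarrow> p dvd a"
  by (auto simp: Legendre_def cong_0_iff)

lemma Legendre_vals: "Legendre a p \<in> {-1, 0, 1}"
  by (auto simp: Legendre_def)

text \<open>Two such values differ by at most 2, which is less than \<open>p\<close>. This turns the
  congruence of Euler's criterion into an equality.\<close>

lemma Legendre_eqI:
  assumes "p > 2" "x \<in> {-1,0,1}" "y \<in> {-1,0,1}" "[x = y] (mod p)"
  shows "x = (y::int)"
proof -
  have "p dvd x - y" using assms(4) by (simp add: cong_iff_dvd_diff)
  moreover have "\<bar>x - y\<bar> < p" using assms(1-3) by auto
  ultimately show ?thesis using zdvd_imp_le[of p "\<bar>x - y\<bar>"] by (cases "x = y") auto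
qed

context
  fixes p :: nat
  assumes p: "prime p" "2 < p"
begin

lemma Legendre_mult: "Legendre (a * b) p = Legendre a p * Legendre b p"
proof (rule Legendre_eqI)
  show "2 < int p" using p by simp
  show "Legendre a p * Legendre b p \<in> {-1, 0, 1}" using Legendre_vals[of a p] Legendre_vals[of b p] by auto
  have "[Legendre a p * Legendre b p = a ^ ((p - 1) div 2) * b ^ ((p - 1) div 2)] (mod p)"
    by (intro cong_mult euler_criterion p)
  then show "[Legendre (a * b) p = Legendre a p * Legendre b p] (mod p)"
    using euler_criterion[OF p, of "a * b"] by (metis cong_sym cong_trans power_mult_distrib)
qed (rule Legendre_vals)

lemma Legendre_minus_1: "Legendre (-1) p = (if p mod 4 = 1 then 1 else -1)"
proof -
  have "odd p" using p prime_odd_nat by auto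
  then have "even ((p - 1) div 2) \<longleftrightarrow> p mod 4 = 1" by presburger
  moreover have "Legendre (-1) p = (-1) ^ ((p - 1) div 2)"
  proof (rule Legendre_eqI)
    show "2 < int p" using p by simp
    show "(-1::int) ^ ((p - 1) div 2) \<in> {-1, 0, 1}" by (cases "even ((p - 1) div 2)") auto
  qed (use Legendre_vals euler_criterion[OF p] in auto)
  ultimately show ?thesis by auto
qed

lemma Legendre_1: "Legendre 1 p = 1"
  using Legendre_minus_1 Legendre_mult[of "-1" "-1"] by (auto split: if_splits)

end

section \<open>Jacobi symbols and reciprocity\<close>

definition jacobi :: "nat \<Rightarrow> int \<Rightarrow> int" where
  "jacobi N a = (\<Prod>q\<in>#prime_factorization N. Legendre a (int q))"

lemma jacobi_1 [simp]: "jacobi (Suc 0) a = 1"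
  by (simp add: jacobi_def)

lemma jacobi_prime_times: "prime q \<Longrightarrow> N > 0 \<Longrightarrow> jacobi (q * N) a = Legendre a q * jacobi N a"
  by (simp add: jacobi_def prime_factorization_mult prime_factorization_prime)

lemma odd_induct [consumes 1, case_names one prime_times]:
  assumes "odd (N::nat)" "P 1"
    and "\<And>q N. prime q \<Longrightarrow> 2 < q \<Longrightarrow> odd N \<Longrightarrow> N > 0 \<Longrightarrow> P N \<Longrightarrow> P (q * N)"
  shows "P N"
  using assms(1)
proof (induction N rule: prime_divisors_induct)
  case (factor q N)
  then have "odd q" "odd N" by auto
  moreover have "q > 2" using factor(1) \<open>odd q\<close> prime_ge_2_nat[of q] by (cases "q = 2") auto
  moreover have "N > 0" using \<open>odd N\<close> by (auto intro!: Nat.gr0I)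
  ultimately show ?case using assms(3)[of q N] factor by auto
qed (use assms(2) in auto)

lemma odd_mod4_mult: "odd x \<Longrightarrow> odd y \<Longrightarrow> (x * y) mod 4 = 1 \<longleftrightarrow> (x mod 4 = 1 \<longleftrightarrow> y mod 4 = (1::nat))"
proof -
  assume "odd x" "odd y"
  then have "x mod 4 = 1 \<or> x mod 4 = 3" "y mod 4 = 1 \<or> y mod 4 = 3" by presburger+
  then show ?thesis by (auto simp: mod_mult_eq[of x 4 y, symmetric])
qed

lemma jacobi_mult: "odd N \<Longrightarrow> jacobi N (a * b) = jacobi N a * jacobi N b"
  by (induction N rule: odd_induct) (auto simp: jacobi_prime_times Legendre_mult)

lemma jacobi_cong: "odd N \<Longrightarrow> [a = b] (mod (int N)) \<Longrightarrow> jacobi N a = jacobi N b"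
proof (induction N rule: odd_induct)
  case (prime_times q N)
  then have "[a = b] (mod (int q * int N))" by simp
  then have "[a = b] (mod q)" "[a = b] (mod (int N))"
    by (metis cong_dvd_modulus dvd_triv_left, metis cong_dvd_modulus dvd_triv_right)
  then show ?case using prime_times by (simp add: jacobi_prime_times Legendre_cong)
qed simp

lemma jacobi_vals: "odd N \<Longrightarrow> if coprime a (int N) then jacobi N a \<in> {-1, 1} else jacobi N a = 0"
proof (induction N rule: odd_induct)
  case (prime_times q N)
  have "coprime a (int q) \<longleftrightarrow> \<not> int q dvd a"
    using prime_times(1) by (metis coprime_commute prime_imp_coprime coprime_absorb_left not_prime_unit prime_nat_int_transfer)
  then have "if coprime a (int q) then Legendre a q \<in> {-1, 1} else Legendre a q = 0"
    using Legendre_eq_0_iff[of a q] Legendre_vals[of a q] by auto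
  then show ?case using prime_times by (auto simp: jacobi_prime_times split: if_splits)
qed simp

lemma jacobi_minus_1: "odd N \<Longrightarrow> jacobi N (-1) = (if N mod 4 = 1 then 1 else -1)"
proof (induction N rule: odd_induct)
  case (prime_times q N)
  have "odd q" using prime_times prime_odd_nat by auto
  then show ?case using prime_times odd_mod4_mult[of q N] by (auto simp: jacobi_prime_times Legendre_minus_1)
qed simp

text \<open>Quadratic reciprocity, multiplied over the prime factors of \<open>N\<close>; by
  \<open>odd_mod4_mult\<close> the signs multiply as well.\<close>

lemma Legendre_eq_jacobi:
  assumes "odd N" "prime p" "2 < p" "coprime p N"
  shows "Legendre (int N) p = jacobi N p * (if p mod 4 = 1 \<or> N mod 4 = 1 then 1 else -1)"
  using assms(1,4)
proof (induction N rule: odd_induct)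
  case one
  then show ?case using Legendre_1[OF assms(2,3)] by simp
next
  case (prime_times q N)
  have q: "odd q" using prime_times prime_odd_nat by auto
  have p: "odd p" using assms prime_odd_nat by auto
  have "p \<noteq> q" using prime_times assms(2) by auto
  then have qr: "Legendre p q * Legendre q p = (-1) ^ ((p - 1) div 2 * ((q - 1) div 2))"
    using Quadratic_Reciprocity assms(2,3) prime_times by blast
  have "even ((p - 1) div 2) \<longleftrightarrow> p mod 4 = 1" "even ((q - 1) div 2) \<longleftrightarrow> q mod 4 = 1"
    using p q by presburger+
  then have sgn: "Legendre p q * Legendre q p = (if p mod 4 = 1 \<or> q mod 4 = 1 then 1 else -1)"
    unfolding qr by auto
  then have "Legendre q p = Legendre p q * (if p mod 4 = 1 \<or> q mod 4 = 1 then 1 else -1)"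
    using Legendre_vals[of p q] Legendre_vals[of q p] by (auto split: if_splits)
  moreover have "coprime p N" using prime_times by simp
  ultimately show ?case using prime_times odd_mod4_mult[OF q \<open>odd N\<close>] Legendre_mult[OF assms(2,3)]
    by (auto simp: jacobi_prime_times)
qed

section \<open>Square roots modulo \<open>c\<close> and the choice of \<open>c\<close>\<close>

text \<open>One prime factor is added at a time: a new prime by the Chinese remainder theorem, a
  repeated one by Hensel lifting, since \<open>2 * r\<close> is invertible modulo
  \<open>p\<close>.\<close>

lemma square_root_mod:
  fixes c :: nat and D :: int
  assumes "c > 0" "\<And>p. prime p \<Longrightarrow> p dvd c \<Longrightarrow> 2 < p \<and> \<not> int p dvd D \<and> QuadRes p D"
  shows "\<exists>r. int c dvd r^2 - D"
  using assms
proof (induction c rule: prime_divisors_induct)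
  case (unit c)
  then show ?case by auto
next
  case (factor p c)
  have pr: "prime p" "2 < p" "\<not> int p dvd D" "QuadRes p D" and c0: "c > 0"
    using factor by auto
  obtain r where r: "int c dvd r^2 - D" using factor c0 by auto
  have ip: "prime (int p)" using pr by simp
  show ?case
  proof (cases "p dvd c")
    case True
    obtain g where g: "r^2 - D = int c * g" using r by auto
    have "int p dvd r^2 - D" using True r by (meson dvd_trans of_nat_dvd_iff)
    then have "\<not> int p dvd r" using pr(3) by (metis dvd_diff_right_iff dvd_power dvd_trans zero_less_numeral)
    moreover have "\<not> int p dvd 2" using pr(2) by (auto dest: zdvd_imp_le)
    ultimately have "\<not> int p dvd 2 * r" using ip by (simp add: prime_dvd_mult_iff)
    then have "coprime (2 * r) (int p)" using ip by (metis coprime_commute prime_imp_coprime)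
    then obtain t where t: "[2 * r * t = 1] (mod int p)" using cong_solve_coprime_int by blast
    \<comment> \<open>The Hensel correction: as \<open>t\<close> inverts \<open>2 * r\<close>, this
      choice makes \<open>g + 2 * r * y\<close> divisible by \<open>p\<close>.\<close>
    define y where "y = - g * t"
    have "g + 2 * r * y = g * (1 - 2 * r * t)" by (simp add: y_def algebra_simps)
    then have 1: "int p dvd g + 2 * r * y" using t by (simp add: cong_iff_dvd_diff dvd_diff_commute)
    have 2: "int p dvd int c * y^2" using True by simp
    have "(r + int c * y)^2 - D = int c * (g + 2 * r * y + int c * y^2)"
      using g by (simp add: power2_eq_square algebra_simps)
    moreover have "int p * int c dvd int c * (g + 2 * r * y + int c * y^2)"
      using dvd_add[OF 1 2] by (simp add: mult.commute mult_dvd_mono)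
    ultimately show ?thesis by (metis of_nat_mult)
  next
    case False
    obtain y where y: "[y^2 = D] (mod int p)" using pr(4) by (auto simp: QuadRes_def)
    have co: "coprime (int p) (int c)" using False pr(1) by (simp add: prime_imp_coprime)
    then obtain x where x: "[x = y] (mod int p)" "[x = r] (mod int c)" using binary_chinese_remainder_int by blast
    have "[x^2 = D] (mod int p)" using x(1) y cong_pow cong_trans by blast
    moreover have "[x^2 = D] (mod int c)" using x(2) r cong_pow cong_trans cong_iff_dvd_diff by blast
    ultimately have "int p * int c dvd x^2 - D" using co by (simp add: cong_iff_dvd_diff divides_mult)
    then show ?thesis by auto
  qed
qed auto

lemma nonresidue_mod_5: "[(y::int)^2 \<noteq> 2] (mod 5)"
proof -
  have "y mod 5 \<in> {0,1,2,3,4}" by auto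
  then show ?thesis by (auto simp: cong_def power_mod[of y 5 2, symmetric])
qed

lemma Legendre_2_5: "Legendre 2 5 = -1"
  using nonresidue_mod_5 by (auto simp: Legendre_def QuadRes_def cong_0_iff)

lemma prime_5: "prime (5::nat)"
  unfolding prime_nat_iff
proof (intro conjI allI impI)
  fix n :: nat assume n: "n dvd 5"
  then have "n \<le> 5" using dvd_imp_le by auto
  then have "n \<in> {0,1,2,3,4,5}" by auto
  then show "n = 1 \<or> n = 5" using n by auto
qed simp

text \<open>A product \<open>c\<close> of primes that split for the character of
  \<open>- 5 * N\<close> has \<open>- 5 * N\<close> as a square modulo \<open>c\<close>. The
  remaining conditions only concern the class of \<open>c\<close> modulo \<open>20 * N\<close> up to
  squares of units.\<close>

lemma exists_binary_form_data:
  assumes N: "odd N" "\<not> 5 dvd (N::nat)"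
  shows "\<exists>c l r::int. c > 0 \<and> int N dvd c + l^2 \<and> c dvd r^2 + 5 * int N \<and> coprime c (int N) \<and> c mod 5 \<in> {2, 3}"
proof -
  define m where "m = 20 * N"
  \<comment> \<open>The factor \<open>s\<close> combines the symbol of \<open>-1\<close> with the
    reciprocity sign, so that \<open>\<eta> p\<close> is the Legendre symbol of
    \<open>- 5 * N\<close> at every prime \<open>p\<close> not dividing \<open>m\<close>.\<close>
  define s :: "nat \<Rightarrow> int" where
    "s = (\<lambda>n. if n mod 4 = 1 then 1 else if n mod 4 = 3 then (if N mod 4 = 1 then -1 else 1) else 0)"
  define \<eta> :: "nat \<Rightarrow> real" where "\<eta> = (\<lambda>n. of_int (s n * Legendre n 5 * jacobi N n))"
  have N0: "N > 0" using N(1) by (auto intro!: Nat.gr0I)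
  have p5: "prime (5::nat)" "2 < (5::nat)" using prime_5 by auto
  have s_cong: "s n = s k" if "[n = k] (mod 4)" for n k using that by (simp add: s_def cong_def)
  have odd_iff: "odd n \<longleftrightarrow> n mod 4 = 1 \<or> n mod 4 = 3" for n :: nat by presburger
  have s_vals: "if odd n then s n \<in> {-1, 1} else s n = 0" for n
    using odd_iff[of n] by (auto simp: s_def)
  have s_mult: "s (n * k) = s n * s k" for n k
  proof (cases "odd n \<and> odd k")
    case True
    then have "n mod 4 = 1 \<or> n mod 4 = 3" "k mod 4 = 1 \<or> k mod 4 = 3" "(n * k) mod 4 = 1 \<or> (n * k) mod 4 = 3"
      using odd_iff[of n] odd_iff[of k] odd_iff[of "n * k"] by simp_all
    then show ?thesis using odd_mod4_mult[of n k] True unfolding s_def by (elim disjE) simp_all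
  qed (use s_vals[of n] s_vals[of k] s_vals[of "n * k"] in auto)
  have L5_vals: "if coprime n 5 then Legendre (int n) 5 \<in> {-1, 1} else Legendre (int n) 5 = 0" for n
  proof -
    have "coprime n 5 \<longleftrightarrow> \<not> 5 dvd n"
      using prime_5 by (metis coprime_commute prime_imp_coprime coprime_absorb_left not_prime_unit)
    moreover have "5 dvd int n \<longleftrightarrow> 5 dvd n" by presburger
    ultimately show ?thesis using Legendre_eq_0_iff[of n 5] Legendre_vals[of n 5] by auto
  qed
  have coprime_m: "coprime n m \<longleftrightarrow> odd n \<and> coprime n 5 \<and> coprime n N" for n
  proof -
    have m: "m = 2 * (2 * (5 * N))" by (simp add: m_def)
    show ?thesis unfolding m coprime_mult_right_iff by auto
  qed
  have char: "real_character m \<eta>"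
  proof
    show "m > 0" using N0 by (simp add: m_def)
    show "\<eta> (n mod m) = \<eta> n" for n
    proof -
      have c: "[n mod m = n] (mod m)" by (simp add: cong_def)
      have *: "[n mod m = n] (mod 4)" "[n mod m = n] (mod 5)" "[n mod m = n] (mod N)"
        by (rule cong_dvd_modulus_nat[OF c], simp add: m_def)+
      have "[int (n mod m) = int n] (mod int 5)" "[int (n mod m) = int n] (mod int N)"
        using *(2,3) by (simp_all only: cong_int_iff)
      then have "Legendre (int (n mod m)) 5 = Legendre n 5" "jacobi N (int (n mod m)) = jacobi N n"
        by (auto intro: Legendre_cong jacobi_cong[OF N(1)] simp del: of_nat_mod)
      then show ?thesis using s_cong[OF *(1)] unfolding \<eta>_def by (simp only:)
    qed
    show "\<eta> (a * b) = \<eta> a * \<eta> b" for a b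
      using Legendre_mult[OF p5, of a b] by (simp add: \<eta>_def s_mult jacobi_mult[OF N(1)])
    fix n
    show "\<eta> n = 1 \<or> \<eta> n = -1" if "coprime n m"
      using that s_vals[of n] L5_vals[of n] jacobi_vals[OF N(1), of n] by (auto simp: \<eta>_def coprime_m)
    show "\<eta> n = 0" if "\<not> coprime n m"
      using that s_vals[of n] L5_vals[of n] jacobi_vals[OF N(1), of n] by (auto simp: \<eta>_def coprime_m split: if_splits)
  qed
  have cop4N5: "coprime (4 * N) 5"
    using N(2) prime_imp_coprime[OF prime_5, of "4 * N"] prime_dvd_mult_iff[OF prime_5, of 4 N]
    by (auto simp: coprime_commute)
  \<comment> \<open>The class of \<open>-1\<close> modulo \<open>N\<close> makes \<open>- a\<close>
    a square there, and 2 is a nonresidue modulo 5. Residue 3 modulo 4 supplies the sign for which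
    \<open>\<eta> a = 1\<close>, whichever odd residue \<open>N\<close> has modulo 4.\<close>
  then obtain a where a: "[a = 4 * N - 1] (mod 4 * N)" "[a = 2] (mod 5)"
    using binary_chinese_remainder_nat by blast
  have aN: "[int a = -1] (mod int N)"
  proof -
    have "[int a = int (4 * N - 1)] (mod int (4 * N))" using a(1) by (simp only: cong_int_iff)
    then have "[int a = int (4 * N - 1)] (mod int N)" by (rule cong_dvd_modulus) simp
    moreover have "[int (4 * N - 1) = -1] (mod int N)" using N0 by (simp add: cong_iff_dvd_diff of_nat_diff)
    ultimately show ?thesis by (rule cong_trans)
  qed
  have a5: "[int a = 2] (mod 5)" using a(2) cong_int_iff[of a 2 5] by simp
  have a4: "a mod 4 = 3"
  proof -
    have "[a = 4 * N - 1] (mod 4)" using a(1) by (rule cong_dvd_modulus_nat) simp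
    moreover have "4 * N - 1 = 3 + 4 * (N - 1)" using N0 by simp
    then have "(4 * N - 1) mod 4 = 3" by (simp only: mod_mult_self2) simp
    ultimately show ?thesis by (simp add: cong_def)
  qed
  have eta_a: "\<eta> a = 1"
    using a4 Legendre_cong[OF a5] jacobi_cong[OF N(1) aN] jacobi_minus_1[OF N(1)] Legendre_2_5
    by (simp add: \<eta>_def s_def)
  obtain c t where c: "c > 0" "\<forall>p. prime p \<longrightarrow> p dvd c \<longrightarrow> \<eta> p = 1" and t: "coprime t m"
    and ct: "[c * t^2 = a] (mod m)"
    using exists_split_product_in_square_coset[OF char eta_a] by blast
  have root: "2 < p \<and> \<not> int p dvd - 5 * int N \<and> QuadRes p (- 5 * int N)" if "prime p" "p dvd c" for p
  proof -
    have "\<eta> p = 1" using c(2) that by blast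
    then have co: "coprime p m" using real_character.coprimeI[OF char, of p] by simp
    then have co': "odd p" "coprime p 5" "coprime p N" by (simp_all add: coprime_m)
    then have p: "2 < p" using that(1) prime_ge_2_nat[of p] by (cases "p = 2") auto
    have L5: "Legendre 5 p = Legendre p 5"
      using Legendre_eq_jacobi[of 5 p] that(1) p co'(2) prime_5
      by (simp add: jacobi_def prime_factorization_prime)
    have "Legendre (- 5 * int N) p = Legendre (-1) p * Legendre 5 p * Legendre N p"
      using Legendre_mult[OF that(1) p, of "-5" N] Legendre_mult[OF that(1) p, of "-1" 5] by simp
    also have "\<dots> = s p * Legendre p 5 * jacobi N p"
    proof -
      have "p mod 4 = 1 \<or> p mod 4 = 3" using co'(1) by presburger
      then show ?thesis
        using Legendre_minus_1[OF that(1) p] L5 Legendre_eq_jacobi[OF N(1) that(1) p co'(3)]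
        by (auto simp: s_def)
    qed
    also have "\<dots> = 1" using \<open>\<eta> p = 1\<close> unfolding \<eta>_def by linarith
    finally have "Legendre (- 5 * int N) p = 1" .
    then show ?thesis using p by (auto simp: Legendre_def cong_0_iff split: if_splits)
  qed
  obtain r where r: "int c dvd r^2 - (- 5 * int N)" using square_root_mod[OF c(1) root] by blast
  have "coprime t N" using t by (simp add: coprime_m)
  \<comment> \<open>As \<open>c * t^2\<close> is \<open>-1\<close> modulo \<open>N\<close>, the
    inverse \<open>v\<close> of \<open>t\<close> has \<open>c + v^2\<close> divisible by
    \<open>N\<close> and serves as \<open>l\<close>.\<close>
  then obtain v where v: "[t * v = 1] (mod N)" using cong_solve_coprime_nat[of t N] by auto
  have ctN: "[int c * int t^2 = -1] (mod int N)"
  proof -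
    have "[c * t^2 = a] (mod N)" using ct by (rule cong_dvd_modulus_nat) (simp add: m_def)
    then have "[int (c * t^2) = int a] (mod int N)" by (simp only: cong_int_iff)
    then show ?thesis using aN by (simp add: cong_trans)
  qed
  have vN: "[int t * int v = 1] (mod int N)" using v cong_int_iff[of "t * v" 1 N] by simp
  have l: "int N dvd int c + int v^2"
  proof -
    have "[int c * int t^2 * int v^2 = - 1 * int v^2] (mod int N)" using ctN by (rule cong_mult) simp
    moreover have "[int c * (int t * int v)^2 = int c * 1^2] (mod int N)" by (intro cong_mult cong_pow vN) simp
    ultimately have "[int c = - 1 * int v^2] (mod int N)"
      by (simp add: power_mult_distrib mult.assoc) (metis cong_sym cong_trans)
    then show ?thesis by (simp add: cong_iff_dvd_diff)
  qed
  have cN: "coprime (int c) (int N)"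
  proof -
    have "coprime (int c * int t^2) (int N)" using cong_imp_coprime[OF cong_sym[OF ctN]] by simp
    then show ?thesis by simp
  qed
  have c5: "int c mod 5 \<in> {2, 3}"
  proof -
    have "[c * t^2 = a] (mod 5)" using ct by (rule cong_dvd_modulus_nat) (simp add: m_def)
    then have "(c * t^2) mod 5 = 2" using a(2) by (simp add: cong_def)
    then have *: "((c mod 5) * (t mod 5)^2) mod 5 = 2" by (metis mod_mult_eq power_mod mod_mod_trivial)
    have "x \<in> {2, 3}" if "x < 5" "y < 5" "(x * y^2) mod 5 = 2" for x y :: nat
    proof -
      have "x \<in> {0,1,2,3,4}" "y \<in> {0,1,2,3,4}" using that(1,2) by auto
      then show ?thesis using that(3) by auto
    qed
    from this[OF _ _ *] have "c mod 5 \<in> {2, 3}" by simp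
    then show ?thesis using zmod_int[of c 5] by auto
  qed
  show ?thesis using c(1) l r cN c5
    by (intro exI[of _ "int c"] exI[of _ "int v"] exI[of _ r]) simp
qed

section \<open>Ternary forms of determinant 5\<close>

text \<open>The Gram matrix has rows \<open>a f e\<close>, \<open>f b d\<close> and
  \<open>e d c\<close>.\<close>

definition ternary :: "int \<Rightarrow> int \<Rightarrow> int \<Rightarrow> int \<Rightarrow> int \<Rightarrow> int \<Rightarrow> int \<Rightarrow> int \<Rightarrow> int \<Rightarrow> int" where
  "ternary a b c d e f x y z = a * x^2 + b * y^2 + c * z^2 + 2 * d * y * z + 2 * e * x * z + 2 * f * x * y"

definition primitive3 :: "int \<Rightarrow> int \<Rightarrow> int \<Rightarrow> bool" where
  "primitive3 x y z \<longleftrightarrow> (\<forall>p. p dvd x \<longrightarrow> p dvd y \<longrightarrow> p dvd z \<longrightarrow> is_unit p)"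

text \<open>
  The last condition says that the form is anisotropic modulo 5 outside its radical. It separates
  \<open>x^2 + 2 y^2 + 2 y z + 3 z^2\<close> from \<open>x^2 + y^2 + 5 z^2\<close>, the other class of determinant 5.
\<close>
definition admissible :: "int \<Rightarrow> int \<Rightarrow> int \<Rightarrow> int \<Rightarrow> int \<Rightarrow> int \<Rightarrow> int \<Rightarrow> bool" where
  "admissible N a b c d e f \<longleftrightarrow> a > 0 \<and> a * b - f^2 > 0
     \<and> a * b * c + 2 * d * e * f - a * d^2 - b * e^2 - c * f^2 = 5
     \<and> (\<exists>x y z. primitive3 x y z \<and> ternary a b c d e f x y z = N)
     \<and> (\<forall>x y z x' y' z'. 5 dvd ternary a b c d e f x y z \<longrightarrow> 5 dvd ternary a b c d e f x' y' z'
          \<longrightarrow> 5 dvd ternary a b c d e f (x + x') (y + y') (z + z'))"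

lemma primitive3_shift:
  "primitive3 x y z \<Longrightarrow> primitive3 (x - k * y) y z"
  "primitive3 x y z \<Longrightarrow> primitive3 (x - k * z) y z"
  "primitive3 x y z \<Longrightarrow> primitive3 x (y - k * z) z"
  unfolding primitive3_def by (metis diff_add_cancel dvd_add dvd_mult)+

text \<open>The new coefficients come from substituting \<open>x + k * y\<close> for
  \<open>x\<close>. This unimodular change keeps \<open>a\<close>, the leading minor, the
  determinant and primitive representations.\<close>

lemma admissible_shift_xy:
  assumes "admissible N a b c d e f"
  shows "admissible N a (b + 2 * f * k + a * k^2) c (d + e * k) e (f + a * k)"
proof -
  have eq: "ternary a (b + 2 * f * k + a * k^2) c (d + e * k) e (f + a * k) x y z
      = ternary a b c d e f (x + k * y) y z" for x y z
    by (simp add: ternary_def power2_eq_square algebra_simps)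
  obtain x y z where "primitive3 x y z" "ternary a b c d e f x y z = N"
    using assms unfolding admissible_def by blast
  then have "primitive3 (x - k * y) y z"
    "ternary a (b + 2 * f * k + a * k^2) c (d + e * k) e (f + a * k) (x - k * y) y z = N"
    by (simp_all add: eq primitive3_shift)
  moreover have "ternary a b c d e f (x + x' + k * (y + y')) (y + y') (z + z')
     = ternary a b c d e f ((x + k * y) + (x' + k * y')) (y + y') (z + z')" for x y z x' y' z'
    by (simp add: algebra_simps)
  moreover have "a * (b + 2 * f * k + a * k^2) - (f + a * k)^2 = a * b - f^2"
    by (simp add: power2_eq_square algebra_simps)
  moreover have "a * (b + 2 * f * k + a * k^2) * c + 2 * (d + e * k) * e * (f + a * k) - a * (d + e * k)^2
      - (b + 2 * f * k + a * k^2) * e^2 - c * (f + a * k)^2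
    = a * b * c + 2 * d * e * f - a * d^2 - b * e^2 - c * f^2"
    by (simp add: power2_eq_square algebra_simps)
  ultimately show ?thesis using assms unfolding admissible_def eq by metis
qed

lemma admissible_swap_xy:
  assumes "admissible N a b c d e f"
  shows "admissible N b a c e d f"
proof -
  have eq: "ternary b a c e d f x y z = ternary a b c d e f y x z" for x y z
    by (simp add: ternary_def algebra_simps)
  have "a * b > 0" "a > 0" using assms unfolding admissible_def by (smt (verit) zero_le_power2)+
  then have b: "b > 0" by (simp add: zero_less_mult_iff)
  obtain x y z where "primitive3 x y z" "ternary a b c d e f x y z = N"
    using assms unfolding admissible_def by blast
  then have "primitive3 y x z \<and> ternary a b c d e f x y z = N" by (auto simp: primitive3_def)
  moreover have "b * a * c + 2 * e * d * f - b * e^2 - a * d^2 - c * f^2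
      = a * b * c + 2 * d * e * f - a * d^2 - b * e^2 - c * f^2" by (simp add: algebra_simps)
  ultimately show ?thesis using assms b unfolding admissible_def eq by (simp only: mult.commute[of b a]) blast
qed

text \<open>Sylvester's determinant identity with pivot \<open>a\<close>: the minors are the
  coefficients of a binary form whose determinant is \<open>a\<close> times that of the ternary
  form.\<close>

lemma minor_identity:
  "(a * b - f^2) * (a * c - e^2) - (a * d - e * f)^2
     = a * (a * b * c + 2 * d * e * f - a * d^2 - b * e^2 - c * (f::int)^2)"
  by (simp add: power2_eq_square algebra_simps)

lemma admissible_swap_yz:
  assumes "admissible N a b c d e f"
  shows "admissible N a c b d f e"
proof -
  have eq: "ternary a c b d f e x y z = ternary a b c d e f x z y" for x y z
    by (simp add: ternary_def algebra_simps)
  have "(a * b - f^2) * (a * c - e^2) = a * 5 + (a * d - e * f)^2" "a > 0" "a * b - f^2 > 0"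
    using assms minor_identity[of a b f c e d] unfolding admissible_def by auto
  then have "(a * b - f^2) * (a * c - e^2) > 0" by (smt (verit) zero_le_power2)
  then have c: "a * c - e^2 > 0" using \<open>a * b - f^2 > 0\<close> by (simp add: zero_less_mult_iff)
  obtain x y z where "primitive3 x y z" "ternary a b c d e f x y z = N"
    using assms unfolding admissible_def by blast
  then have "primitive3 x z y \<and> ternary a b c d e f x y z = N" by (auto simp: primitive3_def)
  moreover have "a * c * b + 2 * d * f * e - a * d^2 - c * f^2 - b * e^2
      = a * b * c + 2 * d * e * f - a * d^2 - b * e^2 - c * f^2" by (simp add: algebra_simps)
  ultimately show ?thesis using assms c unfolding admissible_def eq by simp blast
qed

lemma admissible_shift_xz:
  assumes "admissible N a b c d e f"
  shows "admissible N a b (c + 2 * e * k + a * k^2) (d + f * k) (e + a * k) f"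
  using admissible_swap_yz[OF admissible_shift_xy[OF admissible_swap_yz[OF assms], of k]] .

lemma admissible_shift_yz:
  assumes "admissible N a b c d e f"
  shows "admissible N a b (c + 2 * d * k + b * k^2) (d + b * k) (e + f * k) f"
  using admissible_swap_xy[OF admissible_shift_xz[OF admissible_swap_xy[OF assms], of k]] .

section \<open>Reduction to a single form\<close>

lemma exists_near_multiple:
  assumes "a > (0::int)"
  shows "\<exists>k. 2 * \<bar>f + a * k\<bar> \<le> a"
proof -
  define q r t where "q = (2 * f + a) div (2 * a)" and "r = (2 * f + a) mod (2 * a)" and "t = a * q"
  have "2 * f + a = 2 * t + r" by (simp add: q_def r_def t_def flip: mult.assoc)
  moreover have "0 \<le> r" "r < 2 * a" using assms by (auto simp: r_def)
  ultimately have "2 * \<bar>f - t\<bar> \<le> a" by arith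
  then have "2 * \<bar>f - a * q\<bar> \<le> a" by (simp only: t_def)
  then show ?thesis by (intro exI[of _ "-q"]) simp
qed

text \<open>Among all admissible forms for \<open>N\<close>, first \<open>a\<close> and then the
  minor \<open>a * b - f^2\<close> is minimised. The two shifts that centre \<open>f\<close> and
  \<open>a * d - e * f\<close> change neither minimum, and comparison with the swapped forms gives
  the other two inequalities.\<close>

lemma admissible_reduced:
  assumes "admissible N a0 b0 c0 d0 e0 f0"
  shows "\<exists>a b c d e f. admissible N a b c d e f \<and> a \<le> b \<and> 2 * \<bar>f\<bar> \<le> a
     \<and> a * b - f^2 \<le> a * c - e^2 \<and> 2 * \<bar>a * d - e * f\<bar> \<le> a * b - f^2"
proof -
  define A where "A = (\<lambda>a. \<exists>b c d e f. admissible N a b c d e f)"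
  define a where "a = int (LEAST n. A (int n))"
  have "A a0" "a0 > 0" using assms unfolding A_def admissible_def by blast+
  then have "A (int (nat a0))" by simp
  then have Aa: "A a" unfolding a_def by (rule LeastI)
  have amin: "a \<le> a'" if "A a'" for a'
  proof -
    have "a' > 0" using that unfolding A_def admissible_def by blast
    then show ?thesis using that Least_le[of "\<lambda>n. A (int n)" "nat a'"] by (simp add: a_def)
  qed
  define B where "B = (\<lambda>m. \<exists>b c d e f. admissible N a b c d e f \<and> a * b - f^2 = m)"
  define m where "m = int (LEAST n. B (int n))"
  have B_pos: "m' > 0" if "B m'" for m' using that unfolding B_def admissible_def by blast
  obtain m0 where "B m0" using Aa unfolding A_def B_def by blast
  then have "B (int (nat m0))" using B_pos[of m0] by simp
  then have Bm: "B m" unfolding m_def by (rule LeastI)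
  have mmin: "m \<le> m'" if "B m'" for m'
  proof -
    show ?thesis using that B_pos[OF that] Least_le[of "\<lambda>n. B (int n)" "nat m'"] by (simp add: m_def)
  qed
  obtain b1 c1 d1 e1 f1 where 1: "admissible N a b1 c1 d1 e1 f1" "a * b1 - f1^2 = m"
    using Bm unfolding B_def by blast
  then have "a > 0" "m > 0" unfolding admissible_def by blast+
  obtain k where k: "2 * \<bar>f1 + a * k\<bar> \<le> a" using exists_near_multiple[OF \<open>a > 0\<close>] by blast
  define b f d2 where "b = b1 + 2 * f1 * k + a * k^2" and "f = f1 + a * k" and "d2 = d1 + e1 * k"
  have 2: "admissible N a b c1 d2 e1 f" using admissible_shift_xy[OF 1(1), of k] by (simp add: b_def f_def d2_def)
  have m: "a * b - f^2 = m" unfolding 1(2)[symmetric] b_def f_def by (simp add: power2_eq_square algebra_simps)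
  obtain j where j: "2 * \<bar>(a * d2 - e1 * f) + m * j\<bar> \<le> m" using exists_near_multiple[OF \<open>m > 0\<close>] by blast
  define c d e where "c = c1 + 2 * d2 * j + b * j^2" and "d = d2 + b * j" and "e = e1 + f * j"
  have 3: "admissible N a b c d e f" using admissible_shift_yz[OF 2, of j] by (simp add: c_def d_def e_def)
  have "a * d - e * f = (a * d2 - e1 * f) + m * j"
    unfolding m[symmetric] d_def e_def by (simp add: power2_eq_square algebra_simps)
  then have r: "2 * \<bar>a * d - e * f\<bar> \<le> a * b - f^2" using j m by simp
  have "a \<le> b" using amin admissible_swap_xy[OF 3] unfolding A_def by blast
  moreover have "m \<le> a * c - e^2" using mmin admissible_swap_yz[OF 3] unfolding B_def by blast
  ultimately show ?thesis using 3 r k unfolding m[symmetric] f_def[symmetric] by blast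
qed

text \<open>The reduction inequalities give \<open>3 * p^2 \<le> 20 * a\<close> and
  \<open>3 * a^2 \<le> 4 * p\<close>, which leave finitely many forms; anisotropy modulo 5 removes
  \<open>x^2 + y^2 + 5 * z^2\<close>.\<close>

lemma admissible_represents:
  assumes "admissible N a0 b0 c0 d0 e0 f0"
  shows "\<exists>t u v. primitive3 t u v \<and> t^2 + 2 * u^2 + 2 * u * v + 3 * v^2 = N"
proof -
  obtain a b c d e f where adm: "admissible N a b c d e f" and ab: "a \<le> b" and fa: "2 * \<bar>f\<bar> \<le> a"
    and le: "a * b - f^2 \<le> a * c - e^2" and off: "2 * \<bar>a * d - e * f\<bar> \<le> a * b - f^2"
    using admissible_reduced[OF assms] by blast
  define p q s where "p = a * b - f^2" and "q = a * c - e^2" and "s = a * d - e * f"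
  have a0: "a > 0" and p0: "p > 0"
    and det: "a * b * c + 2 * d * e * f - a * d^2 - b * e^2 - c * f^2 = 5"
    using adm by (auto simp: admissible_def p_def)
  have pq: "p * q - s^2 = 5 * a" using minor_identity[of a b f c e d] det by (simp add: p_def q_def s_def)
  have sq: "4 * x^2 \<le> y^2" if "2 * \<bar>x\<bar> \<le> y" for x y :: int
    using power_mono[OF that, of 2] by (simp add: power_mult_distrib)
  have "4 * s^2 \<le> p^2" using sq off by (simp add: p_def s_def)
  moreover have "p * p \<le> p * q" using le p0 by (intro mult_left_mono) (auto simp: p_def q_def)
  ultimately have pbound: "3 * p^2 \<le> 20 * a" using pq by (simp add: power2_eq_square)
  have "4 * f^2 \<le> a^2" using sq fa by simp
  moreover have "a * a \<le> a * b" using ab a0 by (intro mult_left_mono) auto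
  ultimately have abound: "3 * a^2 \<le> 4 * p" by (simp add: p_def power2_eq_square)
  have "a \<le> 2"
  proof (rule ccontr)
    assume "\<not> a \<le> 2"
    then have "3 * a \<le> a * a" by (intro mult_right_mono) auto
    then have "9 * a \<le> 4 * p" using abound by (simp add: power2_eq_square)
    then have "(9 * a)^2 \<le> (4 * p)^2" using a0 by (intro power_mono) auto
    then have "81 * a^2 \<le> 16 * p^2" by (simp add: power_mult_distrib)
    then show False using pbound \<open>3 * a \<le> a * a\<close> a0 by (simp add: power2_eq_square)
  qed
  then consider "a = 1" | "a = 2" using a0 by linarith
  then show ?thesis
  proof cases
    case 1
    then have f: "f = 0" using fa by simp
    \<comment> \<open>With \<open>a = 1\<close> a shift clears \<open>e\<close>, and the form splits
      into a square and a binary form of determinant 5.\<close>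
    define c' where "c' = c - e^2"
    have adm': "admissible N 1 b c' d 0 0"
      using admissible_shift_xz[OF adm, of "-e"] 1 f by (simp add: c'_def power2_eq_square)
    have bc: "b * c' - d^2 = 5" using adm' by (simp add: admissible_def)
    have b: "3 * b^2 \<le> 20" "b > 0" "2 * \<bar>d\<bar> \<le> b" using pbound p0 off 1 f by (simp_all add: p_def)
    have "b \<le> 2"
    proof (rule ccontr)
      assume "\<not> b \<le> 2"
      then have "3^2 \<le> b^2" by (intro power_mono) auto
      then show False using b(1) by simp
    qed
    obtain x y z where xyz: "primitive3 x y z" "ternary 1 b c' d 0 0 x y z = N"
      using adm' unfolding admissible_def by blast
    from \<open>b \<le> 2\<close> b(2) consider "b = 1" | "b = 2" by linarith
    then show ?thesis
    proof cases
      case 1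
      have d: "d = 0" using b(3) 1 by simp
      then have "c' = 5" using bc 1 by simp
      note d this
      \<comment> \<open>The vectors \<open>(1, 2, 0)\<close> and \<open>(2, 1, 0)\<close> both have
        value 5, but their sum has value 18, which contradicts closure under addition.\<close>
      moreover have "5 dvd ternary 1 1 5 0 0 0 (1 + 2) (2 + 1) (0 + 0)"
        if "\<And>x y z x' y' z'. 5 dvd ternary 1 1 5 0 0 0 x y z \<Longrightarrow> 5 dvd ternary 1 1 5 0 0 0 x' y' z'
          \<Longrightarrow> 5 dvd ternary 1 1 5 0 0 0 (x + x') (y + y') (z + z')"
        by (rule that) (simp_all add: ternary_def)
      ultimately have False using adm' 1 unfolding admissible_def by (simp add: ternary_def)
      then show ?thesis ..
    next
      case 2
      have "d \<in> {-1, 0, 1}" using b(3) 2 by auto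
      then have "(d = 1 \<or> d = -1) \<and> c' = 3" using bc 2 by auto presburger+
      then show ?thesis
      proof (elim conjE disjE)
        assume "d = 1" "c' = 3"
        then show ?thesis using xyz 2
          by (intro exI[of _ x] exI[of _ y] exI[of _ z]) (simp add: ternary_def)
      next
        assume "d = -1" "c' = 3"
        moreover have "primitive3 x (-y) z" using xyz(1) by (simp add: primitive3_def)
        ultimately show ?thesis using xyz(2) 2
          by (intro exI[of _ x] exI[of _ "-y"] exI[of _ z]) (simp add: ternary_def)
      qed
    qed
  next
    case 2
    have "p \<le> 3"
    proof (rule ccontr)
      assume "\<not> p \<le> 3"
      then have "4^2 \<le> p^2" by (intro power_mono) auto
      then show False using pbound 2 by simp
    qed
    moreover have "p \<ge> 3" using abound 2 by simp
    ultimately have p: "p = 3" by simp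
    then have "2 * \<bar>s\<bar> \<le> 3" using off by (simp add: p_def s_def)
    then have "s \<in> {-1, 0, 1}" by auto
    \<comment> \<open>The minor identity reads \<open>3 * q = 10 + s^2\<close>, and neither 10 nor
      11 is a multiple of 3.\<close>
    then have False using pq p 2 by auto presburger+
    then show ?thesis ..
  qed
qed

section \<open>Gauss's construction of a form with leading coefficient \<open>N\<close>\<close>

text \<open>Since \<open>-1\<close> is a square modulo 5, \<open>- c\<close> is a nonresidue along
  with \<open>c\<close>.\<close>

lemma sum_squares_anisotropic_mod_5:
  fixes c X Y :: int
  assumes "c mod 5 \<in> {2, 3}" "5 dvd c * X^2 + Y^2"
  shows "5 dvd X \<and> 5 dvd Y"
proof -
  have "[(c mod 5) * (X mod 5)^2 + (Y mod 5)^2 = c * X^2 + Y^2] (mod 5)"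
    by (intro cong_add cong_mult cong_pow) (simp_all add: cong_def)
  then have eq: "((c mod 5) * (X mod 5)^2 + (Y mod 5)^2) mod 5 = 0"
    using dvd_imp_mod_0[OF assms(2)] unfolding cong_def by argo
  have residues: "k mod 5 \<in> {0,1,2,3,4}" for k :: int
  proof -
    have "0 \<le> k mod 5" "k mod 5 < 5" by simp_all
    then show ?thesis unfolding insert_iff empty_iff by linarith
  qed
  have "u = 0 \<and> v = 0"
    if "k \<in> {2, 3}" "u \<in> {0,1,2,3,4}" "v \<in> {0,1,2,3,4}" "(k * u^2 + v^2) mod 5 = 0" for k u v :: int
    using that by auto
  from this[OF assms(1) residues residues eq] show ?thesis by (simp add: mod_eq_0_iff_dvd)
qed

text \<open>The minors are prescribed first: \<open>c\<close>, \<open>r\<close> and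
  \<open>e0\<close> with \<open>c * e0 - r^2 = 5 * N\<close>. The congruences modulo
  \<open>N\<close> provide an integral form with leading coefficient \<open>N\<close> and these
  minors; by \<open>minor_identity\<close> its determinant is 5, and \<open>(1, 0, 0)\<close>
  represents \<open>N\<close>.\<close>

lemma ternary_represents_odd_coprime_5:
  assumes N: "N > 0" "odd N" "\<not> 5 dvd N"
  shows "\<exists>t u v. primitive3 t u v \<and> t^2 + 2 * u^2 + 2 * u * v + 3 * v^2 = N"
proof -
  have nN: "int (nat N) = N" using N(1) by simp
  have "odd (nat N)" "\<not> 5 dvd nat N"
    using N(1,2) N(3) int_dvd_int_iff[of 5 "nat N"] by (simp_all add: even_nat_iff)
  then obtain c l r where c: "c > 0" "N dvd c + l^2" "c dvd r^2 + 5 * N" "coprime c N" "c mod 5 \<in> {2, 3}"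
    using exists_binary_form_data[of "nat N"] unfolding nN by blast
  obtain e0 where e0: "r^2 + 5 * N = c * e0" using c(3) by blast
  obtain b where b: "c + l^2 = N * b" using c(2) by blast
  have "coprime l N"
  proof (rule coprimeI)
    fix p assume p: "p dvd l" "p dvd N"
    then have "p dvd N * b" "p dvd l^2" by (auto simp: power2_eq_square)
    then have "p dvd N * b - l^2" by (rule dvd_diff)
    then have "p dvd c" using b by (metis add_diff_cancel_right')
    then show "is_unit p" using coprime_common_divisor[OF c(4) _ p(2)] by blast
  qed
  then obtain l' where l': "[l * l' = 1] (mod N)" using cong_solve_coprime_int by blast
  \<comment> \<open>This choice makes \<open>l * m + r\<close> divisible by \<open>N\<close>, so
    that \<open>d\<close> is integral.\<close>
  define m where "m = - l' * r"
  have "l * m + r = - ((l * l' - 1) * r)" by (simp add: m_def algebra_simps)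
  moreover have "N dvd l * l' - 1" using l' by (simp add: cong_iff_dvd_diff)
  ultimately have "N dvd l * m + r" by (simp only: dvd_minus_iff dvd_mult2)
  then obtain d where d: "l * m + r = N * d" by blast
  have cb: "c = N * b - l^2" and rd: "r = N * d - l * m" using b d by simp_all
  have "c * (m^2 + e0) = N * (b * m^2 + N * d^2 - 2 * d * l * m + 5)"
  proof -
    have "c * (m^2 + e0) = c * m^2 + r^2 + 5 * N" by (simp add: distrib_left flip: e0)
    also have "\<dots> = (N * b - l^2) * m^2 + (N * d - l * m)^2 + 5 * N" by (simp only: cb[symmetric] rd[symmetric])
    finally show ?thesis by (simp add: power2_eq_square algebra_simps)
  qed
  then have "N dvd c * (m^2 + e0)" by simp
  then have "N dvd m^2 + e0" using c(4) by (simp add: coprime_commute coprime_dvd_mult_right_iff)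
  then obtain c' where c': "m^2 + e0 = N * c'" by blast
  then have ec: "e0 = N * c' - m^2" by simp
  let ?F = "ternary N b c' d m l"
  \<comment> \<open>Completing the square twice. Modulo 5 the last term vanishes and an anisotropic
    binary form remains, so the zeros are cut out by two linear congruences and are closed under
    addition.\<close>
  have key: "c * (N * ?F x y z) = c * (N * x + l * y + m * z)^2 + (c * y + r * z)^2 + 5 * N * z^2" for x y z
  proof -
    have "N * ?F x y z = (N * x + l * y + m * z)^2 + c * y^2 + 2 * r * y * z + e0 * z^2"
      unfolding cb rd ec ternary_def by (simp add: power2_eq_square algebra_simps)
    moreover have "c * (c * y^2 + 2 * r * y * z + e0 * z^2) = (c * y + r * z)^2 + (c * e0 - r^2) * z^2"
      by (simp add: power2_eq_square algebra_simps)
    moreover have "c * e0 - r^2 = 5 * N" using e0 by simp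
    ultimately show ?thesis by (simp add: distrib_left add.assoc)
  qed
  have iff: "5 dvd ?F x y z \<longleftrightarrow> 5 dvd N * x + l * y + m * z \<and> 5 dvd c * y + r * z" for x y z
  proof
    assume "5 dvd ?F x y z"
    then have "5 dvd c * (N * ?F x y z) - 5 * N * z^2" by (simp add: mult.assoc)
    then have "5 dvd c * (N * x + l * y + m * z)^2 + (c * y + r * z)^2" unfolding key by simp
    then show "5 dvd N * x + l * y + m * z \<and> 5 dvd c * y + r * z"
      using sum_squares_anisotropic_mod_5 c(5) by blast
  next
    assume "5 dvd N * x + l * y + m * z \<and> 5 dvd c * y + r * z"
    then have "5 dvd c * (N * ?F x y z)" unfolding key by (simp add: mult.assoc power2_eq_square)
    moreover have "\<not> 5 dvd c" using c(5) by auto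
    moreover have "prime (5::int)" using prime_5 by (metis of_nat_numeral prime_nat_int_transfer)
    ultimately show "5 dvd ?F x y z" using N(3) by (simp add: prime_dvd_mult_iff)
  qed
  have "admissible N N b c' d m l"
    unfolding admissible_def
  proof (intro conjI allI impI)
    show "N > 0" "N * b - l^2 > 0" using N(1) c(1) cb by simp_all
    have "N * (N * b * c' + 2 * d * m * l - N * d^2 - b * m^2 - c' * l^2) = c * e0 - r^2"
      unfolding minor_identity[symmetric] cb rd ec by (simp add: mult.commute)
    also have "\<dots> = N * 5" using e0 by simp
    finally show "N * b * c' + 2 * d * m * l - N * d^2 - b * m^2 - c' * l^2 = 5" using N(1) by simp
    show "\<exists>x y z. primitive3 x y z \<and> ?F x y z = N"
      by (intro exI[of _ 1] exI[of _ 0]) (simp add: primitive3_def ternary_def)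
  next
    fix x y z x' y' z' assume "5 dvd ?F x y z" "5 dvd ?F x' y' z'"
    then have "5 dvd N * x + l * y + m * z" "5 dvd c * y + r * z" "5 dvd N * x' + l * y' + m * z'" "5 dvd c * y' + r * z'"
      unfolding iff by blast+
    then have "5 dvd (N * x + l * y + m * z) + (N * x' + l * y' + m * z')" "5 dvd (c * y + r * z) + (c * y' + r * z')"
      by (simp_all only: dvd_add)
    then show "5 dvd ?F (x + x') (y + y') (z + z')" unfolding iff by (simp add: algebra_simps)
  qed
  then show ?thesis by (rule admissible_represents)
qed

section \<open>The quaternary form\<close>

lemma primitive_Gcd:
  fixes x y z w :: int
  assumes "\<And>p. p dvd x \<Longrightarrow> p dvd y \<Longrightarrow> p dvd z \<Longrightarrow> p dvd w \<Longrightarrow> is_unit p"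
  shows "Gcd {x, y, z, w} = 1"
proof -
  have "is_unit (Gcd {x, y, z, w})" by (rule assms; rule Gcd_dvd; simp)
  then show ?thesis by (metis normalize_1_iff normalize_Gcd is_unit_normalize)
qed

definition Q_primitive :: "int \<Rightarrow> bool" where
  "Q_primitive n \<longleftrightarrow> (\<exists>x y z w. Q45_1 x y z w = n \<and> Gcd {x, y, z, w} = 1)"

definition primitive4 :: "int \<Rightarrow> int \<Rightarrow> int \<Rightarrow> int \<Rightarrow> bool" where
  "primitive4 x t a b \<longleftrightarrow> (\<forall>p. p dvd x \<longrightarrow> p dvd t \<longrightarrow> p dvd a \<longrightarrow> p dvd b \<longrightarrow> is_unit p)"

text \<open>The vectors \<open>y, z, w\<close> of the Gram matrix correspond to \<open>(t, a, b) = (0, 1, 0), (-1, 0, 1), (-2, 1, -1)\<close>.\<close>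
lemma Q_primitive_of_cong:
  assumes "primitive4 x t a b" "3 dvd t + b"
    "x^2 + t^2 + 2 * a^2 + 2 * a * b + 3 * b^2 = n"
  shows "Q_primitive n"
proof -
  from assms(2) obtain w where w: "t + b = 3 * - w" by (metis dvd_def minus_minus)
  then have t: "t = - b - 3 * w" by simp
  define z y where "z = b + w" and "y = a - w"
  have "Q45_1 x y z w = n"
    unfolding assms(3)[symmetric] Q45_1_def t z_def y_def by (simp add: power2_eq_square algebra_simps)
  moreover have "Gcd {x, y, z, w} = 1"
  proof (rule primitive_Gcd)
    fix p assume p: "p dvd x" "p dvd y" "p dvd z" "p dvd w"
    have "p dvd b" using dvd_diff[OF p(3,4)] by (simp add: z_def)
    moreover have "p dvd a" using dvd_add[OF p(2,4)] by (simp add: y_def)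
    moreover have "p dvd t" using \<open>p dvd b\<close> p(4) by (simp add: t)
    ultimately show "is_unit p" using assms(1) p(1) by (simp add: primitive4_def)
  qed
  ultimately show ?thesis unfolding Q_primitive_def by blast
qed

text \<open>The full form is invariant under changing the sign of \<open>t\<close> and under
  exchanging \<open>x\<close> and \<open>t\<close>, so the congruence is only needed up to sign and
  for either variable.\<close>

lemma Q_primitive_of_square_cong:
  assumes "primitive4 x t a b" "3 dvd t^2 - b^2 \<or> 3 dvd x^2 - b^2"
    "x^2 + t^2 + 2 * a^2 + 2 * a * b + 3 * b^2 = n"
  shows "Q_primitive n"
proof -
  have *: "Q_primitive n" if "primitive4 x t a b" "3 dvd t^2 - b^2"
    "x^2 + t^2 + 2 * a^2 + 2 * a * b + 3 * b^2 = n" for x t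
  proof -
    have "t^2 - b^2 = (t + b) * (t - b)" by (simp add: power2_eq_square algebra_simps)
    then have "3 dvd t + b \<or> 3 dvd t - b" using that(2) by (simp add: prime_dvd_mult_iff)
    then show ?thesis
    proof
      assume "3 dvd t + b"
      then show ?thesis using Q_primitive_of_cong that(1,3) by blast
    next
      assume "3 dvd t - b"
      then have "3 dvd - t + b" by (metis dvd_minus_iff minus_diff_eq uminus_add_conv_diff)
      moreover have "primitive4 x (- t) a b" using that(1) by (simp add: primitive4_def)
      ultimately show ?thesis using Q_primitive_of_cong[of x "-t" a b n] that(3) by simp
    qed
  qed
  from assms(2) show ?thesis
  proof
    assume "3 dvd x^2 - b^2"
    moreover have "primitive4 t x a b" using assms(1) by (auto simp: primitive4_def)
    ultimately show ?thesis using *[of t x] assms(3) by (simp add: add.commute)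
  qed (use * assms in blast)
qed

text \<open>
  Reflection in the vector \<open>(x, t, a, b) = (1, 0, \<epsilon>, 0)\<close> of norm 3, where \<open>3 k\<close> is the inner product with it.
  Since \<open>9\<close> does not divide \<open>x\<close>, one of the two signs makes the new \<open>x\<close> prime to 3.
\<close>
lemma Q_primitive_reflection:
  assumes prim: "primitive4 x t a b" and x: "3 dvd x" "\<not> 9 dvd x" and res: "3 dvd a - b" "\<not> 3 dvd b"
    and n: "x^2 + t^2 + 2 * a^2 + 2 * a * b + 3 * b^2 = n"
  shows "Q_primitive n"
proof -
  have "\<exists>\<epsilon>\<in>{-1, 1}. \<not> 9 dvd x + \<epsilon> * (2 * a + b)"
    using x by auto presburger
  then obtain \<epsilon> where eps: "\<epsilon> \<in> {-1, 1}" "\<not> 9 dvd x + \<epsilon> * (2 * a + b)" by blast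
  have "3 dvd 2 * a + b" using res by presburger
  then have "3 dvd x + \<epsilon> * (2 * a + b)" using x by simp
  then obtain k where k: "x + \<epsilon> * (2 * a + b) = 3 * k" by blast
  have k3: "\<not> 3 dvd k" using eps(2) unfolding k by presburger
  have ee: "\<epsilon> * \<epsilon> = 1" using eps(1) by auto
  define x' a' where "x' = x - 2 * k" and "a' = a - 2 * \<epsilon> * k"
  have "x'^2 + t^2 + 2 * a'^2 + 2 * a' * b + 3 * b^2
      = n - 4 * k * (x + \<epsilon> * (2 * a + b)) + (4 + 8 * (\<epsilon> * \<epsilon>)) * k^2"
    unfolding n[symmetric] x'_def a'_def by (simp add: power2_eq_square algebra_simps)
  then have n': "x'^2 + t^2 + 2 * a'^2 + 2 * a' * b + 3 * b^2 = n"
    unfolding k ee by (simp add: power2_eq_square)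
  have "primitive4 x' t a' b"
    unfolding primitive4_def
  proof (intro allI impI)
    fix p assume p: "p dvd x'" "p dvd t" "p dvd a'" "p dvd b"
    \<comment> \<open>A reflection negates the inner product with its root. A common divisor of the
      new vector therefore divides \<open>3 * k\<close>, and then the old vector too.\<close>
    have "x' + \<epsilon> * (2 * a' + b) = 3 * k - 2 * k - 4 * (\<epsilon> * \<epsilon>) * k"
      unfolding k[symmetric] x'_def a'_def by (simp add: algebra_simps)
    then have "x' + \<epsilon> * (2 * a' + b) = - (3 * k)" unfolding ee by simp
    moreover have "p dvd x' + \<epsilon> * (2 * a' + b)" using p by simp
    ultimately have "p dvd 3 * k" by (metis dvd_minus_iff)
    moreover have "coprime p 3"
    proof -
      have "\<not> 3 dvd p" using p(4) res(2) dvd_trans by blast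
      then show ?thesis using prime_imp_coprime[of 3 p] by (simp add: coprime_commute)
    qed
    ultimately have pk: "p dvd k" by (simp add: coprime_dvd_mult_right_iff)
    have "p dvd x' + 2 * k" "p dvd a' + 2 * \<epsilon> * k" using p pk by auto
    then show "is_unit p" using prim p(2,4) unfolding primitive4_def x'_def a'_def by simp
  qed
  moreover have "3 dvd x'^2 - b^2"
  proof -
    have "\<not> 3 dvd x'" using k3 x(1) unfolding x'_def by presburger
    then have "x' mod 3 = 1 \<or> x' mod 3 = 2" "b mod 3 = 1 \<or> b mod 3 = 2" using res(2) by presburger+
    then have "3 dvd x' - b \<or> 3 dvd x' + b" by presburger
    moreover have "x'^2 - b^2 = (x' - b) * (x' + b)" by (simp add: power2_eq_square algebra_simps)
    ultimately show ?thesis by auto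
  qed
  ultimately show ?thesis using Q_primitive_of_square_cong n' by blast
qed

section \<open>The choice of \<open>x\<close>\<close>

text \<open>Oddness and the condition at 5 are what the ternary theorem asks of
  \<open>n - x^2\<close>. The residues modulo 3 force \<open>t^2\<close> or \<open>x^2\<close> to
  agree with \<open>b^2\<close>, except possibly for \<open>n mod 3 = 1\<close>, where the condition
  at 9 serves the reflection.\<close>

definition good_shift :: "int \<Rightarrow> int \<Rightarrow> bool" where
  "good_shift n x \<longleftrightarrow> odd (n - x^2) \<and> \<not> 5 dvd n - x^2 \<and>
     (n mod 3 = 2 \<and> 3 dvd x \<or> n mod 3 = 0 \<and> \<not> 3 dvd x \<or> n mod 3 = 1 \<and> 3 dvd x \<and> \<not> 9 dvd x)"

lemma mod_3_square: "(x::int)^2 mod 3 = (if 3 dvd x then 0 else 1)"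
proof -
  have "x mod 3 = 0 \<or> x mod 3 = 1 \<or> x mod 3 = 2" by presburger
  then show ?thesis by (elim disjE) (auto simp: dvd_eq_mod_eq_0 simp flip: power_mod[of x 3])
qed

lemma Q_primitive_of_good_shift:
  assumes x: "good_shift n x" and prim: "primitive4 x t a b"
    and n: "x^2 + t^2 + 2 * a^2 + 2 * a * b + 3 * b^2 = n"
  shows "Q_primitive n"
proof (cases "3 dvd t^2 - b^2 \<or> 3 dvd x^2 - b^2")
  case True
  then show ?thesis using Q_primitive_of_square_cong prim n by blast
next
  case False
  \<comment> \<open>Modulo 3 the form is \<open>x^2 + t^2 + 2 * A\<close>. If both square
    congruences fail, tabulating \<open>A\<close> leaves only \<open>a\<close> congruent to
    \<open>b\<close>, prime to 3, and \<open>x\<close> divisible by 3.\<close>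
  define A where "A = a * (a + b)"
  have n': "n = x^2 + t^2 + 2 * A + 3 * b^2" using n by (simp add: A_def power2_eq_square algebra_simps)
  have res: "(3 dvd t \<longleftrightarrow> \<not> 3 dvd b)" "(3 dvd x \<longleftrightarrow> \<not> 3 dvd b)"
    using False mod_3_square[of t] mod_3_square[of b] mod_3_square[of x]
    by (auto simp: mod_eq_dvd_iff[symmetric] split: if_splits)
  have A: "A mod 3 = (if a mod 3 = b mod 3 then (if 3 dvd b then 0 else 2)
     else if 3 dvd b then 1 else 0)"
  proof -
    have "a mod 3 = 0 \<or> a mod 3 = 1 \<or> a mod 3 = 2" "b mod 3 = 0 \<or> b mod 3 = 1 \<or> b mod 3 = 2" by presburger+
    moreover have "A mod 3 = ((a mod 3) * ((a mod 3 + b mod 3) mod 3)) mod 3"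
      unfolding A_def by (simp add: mod_simps)
    ultimately show ?thesis by (elim disjE) (auto simp: dvd_eq_mod_eq_0)
  qed
  have shift: "n mod 3 = 2 \<and> 3 dvd x \<or> n mod 3 = 0 \<and> \<not> 3 dvd x \<or> n mod 3 = 1 \<and> 3 dvd x \<and> \<not> 9 dvd x"
    using x unfolding good_shift_def by blast
  have "[n = x^2 mod 3 + t^2 mod 3 + 2 * (A mod 3) + 0 * b^2] (mod 3)"
    unfolding n' by (intro cong_add cong_mult) (simp_all add: cong_def)
  then have nA: "n mod 3 = (x^2 mod 3 + t^2 mod 3 + 2 * (A mod 3)) mod 3"
    by (simp add: cong_def)
  have "3 dvd x \<and> \<not> 9 dvd x \<and> \<not> 3 dvd b \<and> a mod 3 = b mod 3"
  proof (cases "3 dvd b")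
    case True
    then have "x^2 mod 3 = 1" "t^2 mod 3 = 1" "\<not> 3 dvd x" using res by (simp_all add: mod_3_square)
    moreover have "A mod 3 = 0 \<or> A mod 3 = 1" using A True by simp
    ultimately show ?thesis using nA shift by auto
  next
    case False
    then have "x^2 mod 3 = 0" "t^2 mod 3 = 0" "3 dvd x" using res by (simp_all add: mod_3_square)
    then show ?thesis using nA shift A False by (cases "a mod 3 = b mod 3") auto
  qed
  then show ?thesis using Q_primitive_reflection[OF prim _ _ _ _ n] by (simp add: mod_eq_dvd_iff)
qed

text \<open>The numbers for which every good shift \<open>x\<close> has \<open>x^2 \<ge> n\<close>.\<close>
definition small_exceptions :: "int set" where
  "small_exceptions = {1, 2, 3, 4, 5, 6, 7, 8, 9, 13, 14, 19, 25, 31, 34, 35, 44, 61, 64, 74, 91, 94,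
     121, 124, 154, 184, 214}"

lemma Q_primitive_small:
  assumes "n \<in> small_exceptions"
  shows "Q_primitive n"
proof -
  \<comment> \<open>Every listed vector has a coordinate 1, which makes it primitive at
    once.\<close>
  have "\<exists>(n', x, y, z, w)\<in>set [(1, 1, 0, 0, 0), (2, 0, 1, 0, 0), (3, 1, 1, 0, 0), (4, 0, 0, 1, 0), (5, 1, 0, 1, 0),
       (6, 2, 1, 0, 0), (7, 0, 0, 0, 1), (8, 0, 1, 1, 0), (9, 1, 1, 1, 0), (13, 3, 0, 1, 0),
       (14, 0, 1, -2, 0), (19, 0, 2, 0, 1), (25, 3, 2, 1, 0), (31, 0, 1, 2, 1), (34, 0, 1, 0, 2),
       (35, 1, 1, 0, 2), (44, 0, 1, 3, 0), (61, 3, 2, 1, 2), (64, 1, 0, 0, 3), (74, 0, 1, 4, 0),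
       (91, 0, 1, 2, 3), (94, 3, 3, 3, 1), (121, 0, 1, 5, 1), (124, 5, 2, 4, 1), (154, 1, 3, 3, 3),
       (184, 0, 9, 1, 0), (214, 9, 5, 3, 1)].
         n = n' \<and> Q45_1 x y z w = n' \<and> 1 \<in> {x, y, z, w}"
    using assms unfolding small_exceptions_def by (elim insertE) (simp_all add: Q45_1_def)
  then obtain x y z w where "Q45_1 x y z w = n" "1 \<in> {x, y, z, w}" by blast
  moreover from this(2) have "Gcd {x, y, z, w} = 1" using primitive_Gcd by auto
  ultimately show ?thesis unfolding Q_primitive_def by blast
qed

text \<open>The least good shift for each residue modulo 30, with \<open>2, \<dots>, 31\<close> representing the residues.\<close>
definition shifts :: "(int \<times> int) list" where
  "shifts =
    [(2, 3), (3, 2), (4, 15), (5, 6), (6, 5), (7, 6), (8, 3), (9, 4), (10, 3), (11, 0),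
     (12, 1), (13, 6), (14, 9), (15, 2), (16, 3), (17, 0), (18, 1), (19, 6), (20, 3), (21, 2),
     (22, 3), (23, 0), (24, 1), (25, 6), (26, 3), (27, 2), (28, 3), (29, 0), (30, 1), (31, 12)]"

text \<open>Since \<open>225 < 2 + 30 * 8\<close>, the comparison of \<open>x^2\<close> with
  \<open>r + 30 * q\<close> has to be tabulated only for \<open>q < 8\<close>.\<close>

lemma shifts_good:
  "\<forall>(r, x)\<in>set shifts. good_shift r x \<and> x^2 \<le> 225
     \<and> (\<forall>q\<in>{0, 1, 2, 3, 4, 5, 6, 7}. r + 30 * q \<in> small_exceptions \<or> x^2 < r + 30 * q)"
  by (simp add: shifts_def good_shift_def small_exceptions_def)

lemma exists_good_shift:
  assumes "n > 0" "n \<notin> small_exceptions"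
  shows "\<exists>x. x^2 < n \<and> good_shift n x"
proof -
  \<comment> \<open>The number 1 is exceptional, so representatives starting at 2 still give
    \<open>q \<ge> 0\<close>.\<close>
  have "n \<noteq> 1" using assms(2) by (auto simp: small_exceptions_def)
  then have n2: "n \<ge> 2" using assms(1) by simp
  define r q where "r = (n - 2) mod 30 + 2" and "q = (n - 2) div 30"
  have n: "n = r + 30 * q" by (simp add: r_def q_def)
  have "\<forall>r\<in>set [2..31]. r \<in> fst ` set shifts"
    by (simp del: set_upto add: upto_rec_numeral shifts_def)
  moreover have "r \<in> set [2..31]" by (simp only: set_upto atLeastAtMost_iff r_def) simp
  ultimately obtain x where "(r, x) \<in> set shifts" by fastforce
  then have x: "good_shift r x" "x^2 \<le> 225"
    "\<forall>q\<in>{0, 1, 2, 3, 4, 5, 6, 7}. r + 30 * q \<in> small_exceptions \<or> x^2 < r + 30 * q"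
    using shifts_good by blast+
  have "x^2 < n"
  proof (cases "q < 8")
    case True
    moreover have "q \<ge> 0" using n2 by (simp add: q_def pos_imp_zdiv_nonneg_iff)
    ultimately have "q \<in> {0, 1, 2, 3, 4, 5, 6, 7}" unfolding insert_iff empty_iff by linarith
    then show ?thesis using x(3) assms(2) unfolding n by blast
  next
    case False
    moreover have "r \<ge> 2" by (simp add: r_def)
    ultimately show ?thesis using x(2) unfolding n by linarith
  qed
  moreover have "good_shift n x"
  proof -
    have "odd (n - u) \<longleftrightarrow> odd (r - u)" "5 dvd n - u \<longleftrightarrow> 5 dvd r - u" "n mod 3 = r mod 3" for u
      unfolding n by presburger+
    then show ?thesis using x(1) unfolding good_shift_def by simp
  qed
  ultimately show ?thesis by blast
qed

lemma Q_primitive_of_square_shift: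
  assumes "x^2 < n" "good_shift n x"
  shows "Q_primitive n"
proof -
  have "n - x^2 > 0" "odd (n - x^2)" "\<not> 5 dvd n - x^2" using assms unfolding good_shift_def by auto
  then obtain t a b where "primitive3 t a b" "t^2 + 2 * a^2 + 2 * a * b + 3 * b^2 = n - x^2"
    using ternary_represents_odd_coprime_5 by blast
  moreover from this(1) have "primitive4 x t a b" unfolding primitive3_def primitive4_def by blast
  ultimately show ?thesis using Q_primitive_of_good_shift[OF assms(2)] by simp
qed

theorem theorem4p2: "primitively_universal Q45_1"
proof -
  have "Q_primitive n" if "n > 0" for n
  proof (cases "n \<in> small_exceptions")
    case False
    then have "\<exists>x. x^2 < n \<and> good_shift n x" using that by (intro exists_good_shift)
    then show ?thesis using Q_primitive_of_square_shift by blast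
  qed (rule Q_primitive_small)
  then show ?thesis unfolding primitively_universal_def Q_primitive_def by blast
qed

end
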